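(* Let $G$ and $H$ be two (distinct) split graphs on the vertex set $[n]$. Then the pair of vertices $c_G$, $c_H$ of the chordal graph polytope $\operatorname{CGP}_n$ fulfills the rhombus criterion; that is, either $\operatorname{conv}(c_G,c_H)$ is an edge of $\operatorname{CGP}_n$, or there exist vertices $\alpha',\beta'$ of $\operatorname{CGP}_n$, both different from $c_G$ and $c_H$, such that $c_G+c_H=\alpha'+\beta'$.
   Context: $[n]=\{1,\dots,n\}$. All graphs are finite, simple, undirected. A graph is chordal if every cycle of length at least 4 has a chord. A graph $G$ is a split graph if its vertex set can be written as a disjoint union $K_G\,\dot\cup\, O_G$ where $O_G$ is an independent set of $G$ and $G$ restricted to $K_G$ is complete (every split graph is chordal). For a graph $G$ on $[n]$, its characteristic imset is the vector $c_G\in\mathbb{R}^{\{S\subseteq[n]:|S|\ge 2\}}$ with $c_G(S)=1$ if the induced subgraph $G|_S$ is complete and $c_G(S)=0$ otherwise. The chordal graph polytope is $\operatorname{CGP}_n=\operatorname{conv}(c_G: G\text{ is a chordal graph on }[n])$; its vertices are exactly the $c_G$ with $G$ chordal, since these are $0/1$-vectors. An edge of a polytope is a 1-dimensional face. *)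

theory Defs
  imports "HOL-Analysis.Polytope" "HOL-Analysis.Cartesian_Euclidean_Space"
begin

text \<open>
  The vertex set [n] is a finite type \<open>'n\<close> with n elements. A graph on it is identified with its
  set of edges, which are two-element subsets of the type.
\<close>

type_synonym 'n edges = "'n set set"

definition simple_graph :: "'n edges \<Rightarrow> bool" where
  "simple_graph G \<longleftrightarrow> (\<forall>e\<in>G. card e = 2)"

definition complete_on :: "'n edges \<Rightarrow> 'n set \<Rightarrow> bool" where
  "complete_on G S \<longleftrightarrow> (\<forall>u\<in>S. \<forall>v\<in>S. u \<noteq> v \<longrightarrow> {u, v} \<in> G)"

definition independent_in :: "'n edges \<Rightarrow> 'n set \<Rightarrow> bool" where
  "independent_in G S \<longleftrightarrow> (\<forall>u\<in>S. \<forall>v\<in>S. {u, v} \<notin> G)"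

text \<open>
  A cycle is given by the list of its pairwise distinct vertices in cyclic order; a chord is an
  edge of the graph between two vertices of the cycle that is not an edge of the cycle.
\<close>

definition cycle_edges :: "'n list \<Rightarrow> 'n edges" where
  "cycle_edges vs = {{vs ! i, vs ! (Suc i mod length vs)} | i. i < length vs}"

definition cycle_in :: "'n edges \<Rightarrow> 'n list \<Rightarrow> bool" where
  "cycle_in G vs \<longleftrightarrow> 3 \<le> length vs \<and> distinct vs \<and> cycle_edges vs \<subseteq> G"

definition has_chord :: "'n edges \<Rightarrow> 'n list \<Rightarrow> bool" where
  "has_chord G vs \<longleftrightarrow> (\<exists>e\<in>G. e \<subseteq> set vs \<and> e \<notin> cycle_edges vs)"

definition chordal :: "'n edges \<Rightarrow> bool" where
  "chordal G \<longleftrightarrow> simple_graph G \<and> (\<forall>vs. cycle_in G vs \<and> 4 \<le> length vs \<longrightarrow> has_chord G vs)"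

definition split_graph :: "'n edges \<Rightarrow> bool" where
  "split_graph G \<longleftrightarrow> simple_graph G \<and>
     (\<exists>K I. K \<union> I = UNIV \<and> K \<inter> I = {} \<and> complete_on G K \<and> independent_in G I)"

text \<open>
  The space of real vectors indexed by the sets \<open>S\<close> with at least two elements is embedded as a
  coordinate subspace of \<open>real ^ 'n set\<close>: the coordinates at sets with fewer than two elements
  are constantly 0. Convex hulls, faces, their dimensions and extreme points are unaffected.
\<close>

definition char_imset :: "('n::finite) edges \<Rightarrow> real ^ ('n set)" where
  "char_imset G = (\<chi> S. if 2 \<le> card S \<and> complete_on G S then 1 else 0)"

definition CGP :: "(real ^ ('n::finite set)) set" where
  "CGP = convex hull {char_imset G | G. chordal G}"

text \<open>The vertices of a polytope are its extreme points.\<close>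

definition rhombus_criterion :: "'a::euclidean_space set \<Rightarrow> 'a \<Rightarrow> 'a \<Rightarrow> bool" where
  "rhombus_criterion P a b \<longleftrightarrow>
     (convex hull {a, b}) edge_of P \<or>
     (\<exists>a' b'. a' extreme_point_of P \<and> b' extreme_point_of P \<and>
        a' \<notin> {a, b} \<and> b' \<notin> {a, b} \<and> a + b = a' + b')"

end

theory Submission imports Defs begin

text \<open>
  If every representation of the midpoint of \<open>c_G\<close>
      and \<open>c_H\<close> as a convex combination of vertices
  uses only \<open>c_G\<close>
      and \<open>c_H\<close>, the segment is an edge. Otherwise some third chordal graph occurs in
  such a representation. The graphs that occur form a family W on which every inequality that is
  valid on W and tight at the midpoint is tight. So a D in W contains \<open>G \<inter> H\<close>, each of its cliques
  is a clique of G or of H, the edges of \<open>G - H\<close> inside one clique of G lie all in D or all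
  outside D, and an implication between agreements with G on two edges is an equivalence on W.

  With G = K + independent and H = L + independent, this ties most of \<open>G - H\<close> to the edges inside K
  (the core). What remains are small stars: at v outside K, when the neighbourhood of v in G is
  also a clique of H. If both cores are tied to each other, a star not tied to them can be
  exchanged between G and H, possibly together with the other stars of a cycle. If they are not
  tied, W contains a graph with both cores, and one with neither. The first one, stripped of some
  stars, and its complement in the edges where G and H differ form the other diagonal of the rhombus.
\<close>

section \<open>Chordal graphs\<close>

text \<open>The sought diagonal is \<open>swap G P\<close>, \<open>swap H P\<close> for a set
  \<open>P\<close> of edges on which the graphs differ. A clique of \<open>G\<close> that is no
  clique of \<open>H\<close> must survive in exactly one of the two new graphs, so \<open>P\<close>
  contains all or none of its edges outside \<open>H\<close>; this is why ties between edges decide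
  everything. Members of \<open>W\<close> respect the ties, are chordal and have no new cliques, but
  the complement of a member inherits only the ties: this is the obstacle. Exchanges are therefore
  assembled from a few edges wherever possible, and a modified member \<open>D1\<close> serves only
  when these fail; their failure then supplies the facts that make the complement chordal. Stars
  with centre in exactly one of \<open>K\<close>, \<open>L\<close> cannot always move alone: adding
  such an edge to the other graph makes a triangle with a star edge leaving its far end, a clique of
  neither graph, unless that edge moves too. At most one such edge leaves each vertex, so the forced
  moves follow a path or close up to a cycle. With both cores empty, moving the edges at one vertex
  may turn \<open>G\<close> into \<open>H\<close> altogether; then union and intersection take
  over.\<close>

lemma cycle_in_simplicial_has_chord:
  assumes cyc: "cycle_in D vs" and len: "4 \<le> length vs" and v: "v \<in> set vs"
    and simp: "\<And>x y. x \<in> set vs \<Longrightarrow> y \<in> set vs \<Longrightarrow>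
        x \<noteq> y \<Longrightarrow> {v, x} \<in> D \<Longrightarrow> {v, y} \<in> D \<Longrightarrow>
            {x, y} \<in> D"
  shows "has_chord D vs"
proof -
  let ?n = "length vs"
  from v obtain i where i: "i < ?n" "v = vs ! i" by (auto simp: in_set_conv_nth)
  have dist: "distinct vs" and sub: "cycle_edges vs \<subseteq> D" using cyc by (auto simp: cycle_in_def)
  \<comment> \<open>\<open>j\<close> and \<open>k\<close> are the positions after and before
    \<open>v\<close> on the cycle. Since the cycle has at least four vertices, the edge joining them
    skips \<open>v\<close> without being a cycle edge.\<close>
  define j where "j = Suc i mod ?n"
  define k where "k = (if i = 0 then ?n - 1 else i - 1)"
  have j: "j < ?n" and k: "k < ?n" using i len by (auto simp: j_def k_def intro!: mod_less_divisor)
  have ki: "Suc k mod ?n = i" using i len by (auto simp: k_def)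
  have jc: "j = (if Suc i = ?n then 0 else Suc i)" using i by (auto simp: j_def)
  have jk: "j \<noteq> k" using i len by (auto simp: jc k_def split: if_splits)
  have "{vs ! i, vs ! j} \<in> D" using sub i unfolding j_def cycle_edges_def by blast
  moreover have "{vs ! k, vs ! (Suc k mod ?n)} \<in> D" using sub k unfolding cycle_edges_def by blast
  hence "{vs ! i, vs ! k} \<in> D" unfolding ki by (simp add: insert_commute)
  moreover have "vs ! j \<noteq> vs ! k" using jk j k dist by (simp add: nth_eq_iff_index_eq)
  ultimately have e: "{vs ! j, vs ! k} \<in> D" using simp j k i by auto
  have "{vs ! j, vs ! k} \<notin> cycle_edges vs"
  proof
    assume "{vs ! j, vs ! k} \<in> cycle_edges vs"
    then obtain m where m: "m < ?n" "{vs ! j, vs ! k} = {vs ! m, vs ! (Suc m mod ?n)}"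
      by (auto simp: cycle_edges_def)
    have sm: "Suc m mod ?n < ?n" using m by (auto intro!: mod_less_divisor)
    from m(2) consider "j = m" "k = Suc m mod ?n" | "k = m" "j = Suc m mod ?n"
      using dist j k m(1) sm by (auto simp: doubleton_eq_iff nth_eq_iff_index_eq)
    then show False
    proof cases
      case 1
      have "k = (if Suc j = ?n then 0 else Suc j)" using 1 j by auto
      then show False using len i by (auto simp: jc k_def split: if_splits)
    next
      case 2
      then have "j = i" using ki by simp
      then show False using len i by (auto simp: jc split: if_splits)
    qed
  qed
  moreover have "{vs ! j, vs ! k} \<subseteq> set vs" using j k by auto
  ultimately show ?thesis using e unfolding has_chord_def by blast
qed

text \<open>No vertex is deleted: vertices outside \<open>X\<close> become isolated, so the vertex
  type stays the same.\<close>

definition restrict_graph :: "'n edges \<Rightarrow> 'n set \<Rightarrow> 'n edges" where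
  "restrict_graph D X = {e \<in> D. e \<subseteq> X}"

lemma chordal_restrict:
  assumes "chordal D" shows "chordal (restrict_graph D X)"
proof -
  have "has_chord (restrict_graph D X) vs" if c: "cycle_in (restrict_graph D X) vs" "4 \<le> length vs" for vs
  proof -
    have "cycle_in D vs" using c by (auto simp: cycle_in_def restrict_graph_def)
    then obtain e where e: "e \<in> D" "e \<subseteq> set vs" "e \<notin> cycle_edges vs"
      using assms c by (auto simp: chordal_def has_chord_def)
    have "set vs \<subseteq> X"
    proof
      fix x assume "x \<in> set vs"
      then obtain i where i: "i < length vs" "x = vs ! i" by (auto simp: in_set_conv_nth)
      then have "{vs ! i, vs ! (Suc i mod length vs)} \<in> cycle_edges vs" by (auto simp: cycle_edges_def)
      then show "x \<in> X" using c i by (auto simp: cycle_in_def restrict_graph_def)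
    qed
    with e show ?thesis by (auto simp: has_chord_def restrict_graph_def)
  qed
  then show ?thesis using assms by (auto simp: chordal_def simple_graph_def restrict_graph_def)
qed

text \<open>A perfect elimination ordering of the vertices outside \<open>X\<close>, phrased without
  an order. A cycle inside \<open>X\<close> has a chord by assumption. For any other cycle take
  \<open>Y\<close> to be its vertices outside \<open>X\<close>; the simplicial vertex supplied for
  \<open>Y\<close> lies on the cycle.\<close>

lemma chordal_elimination:
  assumes "simple_graph D" and ch: "chordal (restrict_graph D X)"
    and elim: "\<And>Y. Y \<noteq> {} \<Longrightarrow> Y \<inter> X = {} \<Longrightarrow>
      \<exists>v\<in>Y. \<forall>x\<in>X \<union> Y. \<forall>y\<in>X \<union> Y. x \<noteq> y \<longrightarrow> {v, x} \<in> D \<longrightarrow> {v, y} \<in> D \<longrightarrow> {x, y} \<in> D"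
  shows "chordal D"
proof -
  have "has_chord D vs" if c: "cycle_in D vs" "4 \<le> length vs" for vs
  proof (cases "set vs \<subseteq> X")
    case True
    have "cycle_edges vs \<subseteq> Pow (set vs)"
    proof -
      have "\<And>i. i < length vs \<Longrightarrow> Suc i mod length vs < length vs"
          by (auto intro!: mod_less_divisor)
      then show ?thesis by (auto simp: cycle_edges_def)
    qed
    with c True have "cycle_in (restrict_graph D X) vs" by (auto simp: cycle_in_def restrict_graph_def)
    with ch c have "has_chord (restrict_graph D X) vs" by (auto simp: chordal_def)
    then show ?thesis by (auto simp: has_chord_def restrict_graph_def)
  next
    case False
    then obtain v where v: "v \<in> set vs - X"
      "\<forall>x\<in>X \<union> (set vs - X). \<forall>y\<in>X \<union> (set vs - X). x \<noteq> y \<longrightarrow> {v, x} \<in> D \<longrightarrow> {v, y} \<in> D \<longrightarrow> {x, y} \<in> D"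
      using elim[of "set vs - X"] by blast
    then show ?thesis using cycle_in_simplicial_has_chord[OF c, of v] by blast
  qed
  with assms(1) show ?thesis by (auto simp: chordal_def)
qed

lemma split_chordal:
  assumes "simple_graph D" "complete_on D K" "independent_in D (- K)"
  shows "chordal D"
proof (rule chordal_elimination[where X = "{}"])
  have "restrict_graph D {} = {}" using assms(1) by (auto simp: restrict_graph_def simple_graph_def)
  then show "chordal (restrict_graph D {})"
    by (auto simp: chordal_def simple_graph_def cycle_in_def cycle_edges_def) (metis gr_zeroI not_numeral_le_zero list.size(3))
  fix Y :: "'a set" assume Y: "Y \<noteq> {}"
  show "\<exists>v\<in>Y. \<forall>x\<in>{} \<union> Y. \<forall>y\<in>{} \<union> Y. x \<noteq> y \<longrightarrow> {v, x} \<in> D \<longrightarrow> {v, y} \<in> D \<longrightarrow> {x, y} \<in> D"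
  proof (cases "Y \<subseteq> K")
    case True then show ?thesis using Y assms(2) by (fastforce simp: complete_on_def)
  next
    case False
    then obtain v where "v \<in> Y" "v \<notin> K" by blast
    then show ?thesis using assms(2,3) by (intro bexI[of _ v]) (auto simp: complete_on_def independent_in_def)
  qed
qed (rule assms)

lemma chordal_four_cycle:
  assumes "chordal D" "distinct [a, b, c, d]" "{a, b} \<in> D" "{b, c} \<in> D" "{c, d} \<in> D" "{d, a} \<in> D"
  shows "{a, c} \<in> D \<or> {b, d} \<in> D"
proof -
  have ce: "cycle_edges [a, b, c, d] = {{a, b}, {b, c}, {c, d}, {d, a}}"
  proof -
    have "cycle_edges [a, b, c, d] = (\<lambda>i. {[a,b,c,d] ! i, [a,b,c,d] ! (Suc i mod 4)}) ` {0..<4}"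
      by (auto simp: cycle_edges_def)
    also have "{0..<4::nat} = {0, 1, 2, 3}" by auto
    finally show ?thesis by simp
  qed
  have "cycle_in D [a, b, c, d]" using assms by (auto simp: cycle_in_def ce)
  then have "has_chord D [a, b, c, d]" using assms(1) by (auto simp: chordal_def)
  then obtain e where e: "e \<in> D" "e \<subseteq> {a, b, c, d}" "e \<notin> {{a, b}, {b, c}, {c, d}, {d, a}}"
    by (auto simp: has_chord_def ce)
  have "card e = 2" using e assms(1) by (auto simp: chordal_def simple_graph_def)
  then obtain x y where "e = {x, y}" "x \<noteq> y" by (auto simp: card_2_iff)
  with e have "e = {a, c} \<or> e = {b, d}" by (auto simp: doubleton_eq_iff)
  with e show ?thesis by auto
qed

section \<open>The polytope\<close>

lemma char_imset_nth:
  "char_imset G $ S = (if 2 \<le> card S \<and> complete_on G S then 1 else 0)"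
  by (simp add: char_imset_def)

lemma char_imset_edge: "u \<noteq> v \<Longrightarrow> char_imset G $ {u, v} = (if {u, v} \<in> G then 1 else 0)"
  by (auto simp: char_imset_nth complete_on_def insert_commute)

lemma char_imset_inject:
  assumes "simple_graph G" "simple_graph H" "char_imset G = char_imset H"
  shows "G = H"
proof -
  have "e \<in> G \<longleftrightarrow> e \<in> H" if "card e = 2" for e
  proof -
    from that obtain u v where "e = {u, v}" "u \<noteq> v" by (meson card_2_iff)
    then show ?thesis using char_imset_edge[of u v G] char_imset_edge[of u v H] assms(3)
      by (auto split: if_splits)
  qed
  then show ?thesis using assms(1,2) by (auto simp: simple_graph_def)
qed

text \<open>The polytope lies in the unit cube, and a 0/1 vector is a vertex of the cube.\<close>

lemma char_imset_extreme:
  assumes "chordal D"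
  shows "char_imset D extreme_point_of (CGP :: (real ^ (('n::finite) set)) set)"
proof -
  have box: "x $ S \<in> {0..1}" if "x \<in> CGP" for x :: "real ^ ('n set)" and S
  proof -
    have "CGP \<subseteq> {x :: real ^ ('n set). x $ S \<in> {0..1}}"
      unfolding CGP_def
    proof (rule hull_minimal)
      show "{char_imset G |G. chordal G} \<subseteq> {x :: real ^ ('n set). x $ S \<in> {0..1}}"
        by (auto simp: char_imset_nth)
      show "convex {x :: real ^ ('n set). x $ S \<in> {0..1}}"
        by (auto simp: convex_def intro: convex_bound_le)
    qed
    then show ?thesis using that by auto
  qed
  have "char_imset D \<notin> open_segment x y" if "x \<in> CGP" "y \<in> CGP" for x y
  proof
    assume "char_imset D \<in> open_segment x y"
    then obtain t where t: "0 < t" "t < 1" "x \<noteq> y" "char_imset D = (1 - t) *\<^sub>R x + t *\<^sub>R y"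
      by (auto simp: in_segment)
    have "x $ S = y $ S" for S
    proof -
      have eq: "char_imset D $ S = (1 - t) * x $ S + t * y $ S" using t(4) by simp
      have b: "0 \<le> x $ S" "x $ S \<le> 1" "0 \<le> y $ S" "y $ S \<le> 1" using box that by (auto simp: )
      consider "char_imset D $ S = 0" | "char_imset D $ S = 1" by (metis char_imset_nth)
      then show ?thesis
      proof cases
        case 1
        then have "(1 - t) * x $ S = 0 \<and> t * y $ S = 0"
          using eq b t by (simp add: add_nonneg_eq_0_iff)
        then show ?thesis using t by auto
      next
        case 2
        then have "(1 - t) * (1 - x $ S) + t * (1 - y $ S) = 0" using eq by (simp add: algebra_simps)
        then have "(1 - t) * (1 - x $ S) = 0 \<and> t * (1 - y $ S) = 0"
          using b t by (subst (asm) add_nonneg_eq_0_iff) auto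
        then show ?thesis using t by auto
      qed
    qed
    then show False using t(3) by (auto simp: vec_eq_iff)
  qed
  moreover have "char_imset D \<in> CGP" unfolding CGP_def using assms by (auto intro: hull_inc)
  ultimately show ?thesis by (auto simp: extreme_point_of_def)
qed

text \<open>Weights live on all edge sets and vanish off the chordal ones, so every sum runs over
  the finite type and needs no index set.\<close>

definition midpoint_weights :: "('n::finite) edges \<Rightarrow> 'n edges \<Rightarrow> ('n edges \<Rightarrow> real) \<Rightarrow> bool" where
  "midpoint_weights G H w \<longleftrightarrow> (\<forall>D. 0 \<le> w D) \<and> (\<forall>D. \<not> chordal D \<longrightarrow> w D = 0) \<and> sum w UNIV = 1 \<and>
     (\<forall>S. (\<Sum>D\<in>UNIV. w D * char_imset D $ S) = (char_imset G $ S + char_imset H $ S) / 2)"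

text \<open>All representations of the midpoint are collected, not a single chosen one: a third
  graph must be excluded from each of them before the segment is known to be a face.\<close>

definition midpoint_support :: "('n::finite) edges \<Rightarrow> 'n edges \<Rightarrow> 'n edges set" where
  "midpoint_support G H = {D. \<exists>w. midpoint_weights G H w \<and> 0 < w D}"

lemma CGP_weights:
  assumes "x \<in> (CGP :: (real ^ (('n::finite) set)) set)"
  obtains w :: "('n::finite) edges \<Rightarrow> real" where "\<And>D. 0 \<le> w D"
      "\<And>D. \<not> chordal D \<Longrightarrow> w D = 0" "sum w UNIV = 1"
    "x = (\<Sum>D\<in>UNIV. w D *\<^sub>R char_imset D)"
proof -
  have im: "{char_imset D |D. chordal D} = char_imset ` {D :: 'n edges. chordal D}" by auto
  have "x \<in> convex hull (char_imset ` {D :: 'n edges. chordal D})"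
    using assms by (simp add: CGP_def im)
  then obtain u where u: "\<forall>y\<in>char_imset ` {D :: 'n edges. chordal D}. 0 \<le> u y"
     "sum u (char_imset ` {D :: 'n edges. chordal D}) = 1"
     "(\<Sum>y\<in>char_imset ` {D :: 'n edges. chordal D}. u y *\<^sub>R y) = x"
    by (subst (asm) convex_hull_finite) auto
  have inj: "inj_on char_imset {D :: 'n edges. chordal D}"
    by (rule inj_onI) (auto simp: chordal_def dest: char_imset_inject)
  define w where "w = (\<lambda>D. if chordal D then u (char_imset D) else 0)"
  show thesis
  proof (rule that[of w])
    show "sum w UNIV = 1"
      using u(2) by (simp add: w_def sum.reindex[OF inj] sum.If_cases)
    have "(\<Sum>D\<in>UNIV. w D *\<^sub>R char_imset D) = (\<Sum>D | chordal D. u (char_imset D) *\<^sub>R char_imset D)"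
      by (rule sum.mono_neutral_cong_right) (auto simp: w_def)
    then show "x = (\<Sum>D\<in>UNIV. w D *\<^sub>R char_imset D)"
      using u(3) by (simp add: sum.reindex[OF inj])
  qed (use u in \<open>auto simp: w_def\<close>)
qed

text \<open>Let a point \<open>z\<close> of the segment lie strictly between \<open>x\<close> and
  \<open>y\<close> in the polytope. The midpoint is a combination of \<open>z\<close> and an
  endpoint with positive weight on \<open>z\<close>, so representations of \<open>x\<close> and
  \<open>y\<close> combine to one of the midpoint. Every graph used by \<open>x\<close> then occurs
  in the support, hence is \<open>G\<close> or \<open>H\<close>.\<close>

lemma edge_if_small_support:
  assumes G: "chordal G" and H: "chordal H" and ne: "G \<noteq> H" and sup: "midpoint_support G H \<subseteq> {G, H}"
  shows "(convex hull {char_imset G, char_imset H}) edge_of (CGP :: (real ^ (('n::finite) set)) set)"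
proof -
  let ?a = "char_imset G" and ?b = "char_imset H"
  have neq: "?a \<noteq> ?b" using char_imset_inject G H ne by (auto simp: chordal_def)
  have sub: "convex hull {?a, ?b} \<subseteq> CGP"
    unfolding CGP_def by (rule hull_mono) (use G H in auto)
  have key: "x \<in> convex hull {?a, ?b}"
    if x: "x \<in> CGP" and y: "y \<in> CGP" and t: "0 < t" "t < 1"
      and z: "z = (1 - t) *\<^sub>R x + t *\<^sub>R y" "z \<in> convex hull {?a, ?b}" for x y z t
  proof -
    obtain p where p: "\<And>D. 0 \<le> p D" "\<And>D. \<not> chordal D \<Longrightarrow> p D = 0" "sum p UNIV = 1"
      "x = (\<Sum>D\<in>UNIV. p D *\<^sub>R char_imset D)" by (erule CGP_weights[OF x])
    obtain q where q: "\<And>D. 0 \<le> q D" "\<And>D. \<not> chordal D \<Longrightarrow> q D = 0" "sum q UNIV = 1"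
      "y = (\<Sum>D\<in>UNIV. q D *\<^sub>R char_imset D)" by (erule CGP_weights[OF y])
    obtain u where u: "0 \<le> u" "u \<le> 1" "z = (1 - u) *\<^sub>R ?a + u *\<^sub>R ?b"
      using z(2) unfolding segment_convex_hull[symmetric] in_segment by blast
    \<comment> \<open>the midpoint lies strictly between z and one of the endpoints E, at parameter s\<close>
    obtain s E where s: "0 < s" "s \<le> 1" "chordal E"
        "(1/2) *\<^sub>R (?a + ?b) = s *\<^sub>R z + (1 - s) *\<^sub>R char_imset E"
    proof (cases "u \<le> 1/2")
      case True
      \<comment> \<open>Chosen so that \<open>?a\<close> receives coefficient 1/2. At
        \<open>u = 1/2\<close> it equals 1, as \<open>z\<close> is then the midpoint itself.\<close>
      define s where "s = 1 / (2 * (1 - u))"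
      have s1: "s * (1 - u) = 1/2" using True by (simp add: s_def)
      have s2: "s * u + (1 - s) = 1/2" using s1 by (simp add: algebra_simps)
      then have "(1/2) *\<^sub>R (?a + ?b) = (s * (1 - u)) *\<^sub>R ?a + (s * u + (1 - s)) *\<^sub>R ?b"
        by (simp only: s1 s2 scaleR_add_right)
      also have "\<dots> = s *\<^sub>R z + (1 - s) *\<^sub>R ?b"
        by (simp add: u(3) algebra_simps)
      finally have eq: "(1/2) *\<^sub>R (?a + ?b) = s *\<^sub>R z + (1 - s) *\<^sub>R ?b" .
      show thesis
        by (rule that[OF _ _ H eq]) (use True u in \<open>auto simp: s_def field_simps\<close>)
    next
      case False
      define s where "s = 1 / (2 * u)"
      have s1: "s * u = 1/2" using False by (simp add: s_def)
      have s2: "s * (1 - u) + (1 - s) = 1/2" using s1 by (simp add: algebra_simps)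
      then have "(1/2) *\<^sub>R (?a + ?b) = (s * (1 - u) + (1 - s)) *\<^sub>R ?a + (s * u) *\<^sub>R ?b"
        by (simp only: s1 s2 scaleR_add_right)
      also have "\<dots> = s *\<^sub>R z + (1 - s) *\<^sub>R ?a"
        by (simp add: u(3) algebra_simps)
      finally have eq: "(1/2) *\<^sub>R (?a + ?b) = s *\<^sub>R z + (1 - s) *\<^sub>R ?a" .
      show thesis
        by (rule that[OF _ _ G eq]) (use False u in \<open>auto simp: s_def field_simps\<close>)
    qed
    define w where "w D = s * ((1 - t) * p D + t * q D) + (1 - s) * (if D = E then 1 else 0)" for D
    have sumE: "(\<Sum>D\<in>UNIV. (if D = E then 1 else 0) * f D) = f E" for f :: "'n edges \<Rightarrow> real"
      by (simp add: sum.delta' if_distrib[of "\<lambda>x. x * _"] cong: if_cong)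
    have mw: "midpoint_weights G H w"
      unfolding midpoint_weights_def
    proof (intro conjI allI impI)
      show "0 \<le> w D" for D using p q s t by (auto simp: w_def intro!: add_nonneg_nonneg mult_nonneg_nonneg)
      show "w D = 0" if "\<not> chordal D" for D using that p q s by (auto simp: w_def)
      have "sum w UNIV = s * ((1 - t) * sum p UNIV + t * sum q UNIV) + (1 - s) * 1"
        using sumE[of "\<lambda>_. 1"] by (simp add: w_def sum.distrib flip: sum_distrib_left)
      then show "sum w UNIV = 1" by (simp add: p q)
      fix S
      have "(\<Sum>D\<in>UNIV. w D * char_imset D $ S) =
        s * ((1 - t) * (\<Sum>D\<in>UNIV. p D * char_imset D $ S) + t * (\<Sum>D\<in>UNIV. q D * char_imset D $ S))
         + (1 - s) * (\<Sum>D\<in>UNIV. (if D = E then 1 else 0) * char_imset D $ S)"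
        by (simp only: w_def sum_distrib_left sum.distrib[symmetric]) (rule sum.cong, auto simp: algebra_simps)
      also have "\<dots> = s * ((1 - t) * x $ S + t * y $ S) + (1 - s) * char_imset E $ S"
        by (simp only: sumE) (simp add: p(4) q(4))
      also have "\<dots> = (s *\<^sub>R z + (1 - s) *\<^sub>R char_imset E) $ S" by (simp add: z)
      also have "\<dots> = ((1/2) *\<^sub>R (?a + ?b)) $ S" by (simp only: s(4))
      finally show "(\<Sum>D\<in>UNIV. w D * char_imset D $ S) = (char_imset G $ S + char_imset H $ S) / 2"
        by simp
    qed
    have "p D = 0" if "D \<notin> {G, H}" for D
    proof (rule ccontr)
      assume "p D \<noteq> 0"
      with p(1)[of D] have "0 < p D" by simp
      then have "0 < s * ((1 - t) * p D + t * q D)"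
        using s t q(1)[of D] by (intro mult_pos_pos add_pos_nonneg) auto
      then have "0 < w D" using s by (auto simp: w_def)
      then have "D \<in> midpoint_support G H" using mw by (auto simp: midpoint_support_def)
      then show False using sup that by auto
    qed
    then have pz: "\<forall>D\<in>UNIV - {G, H}. p D = 0" by auto
    have "sum p UNIV = sum p {G, H}" by (rule sum.mono_neutral_right) (use pz in auto)
    then have p1: "p G + p H = 1" using ne p(3) by simp
    have "x = (\<Sum>D\<in>{G, H}. p D *\<^sub>R char_imset D)"
      unfolding p(4) by (rule sum.mono_neutral_right) (use pz in auto)
    then have "x = p G *\<^sub>R ?a + p H *\<^sub>R ?b" using ne by simp
    then show ?thesis using p1 p(1) by (auto simp: convex_hull_2)
  qed
  have "convex hull {?a, ?b} face_of CGP"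
    unfolding face_of_def
  proof (intro conjI ballI impI)
    fix x y z assume *: "x \<in> CGP" "y \<in> CGP" "z \<in> convex hull {?a, ?b}" "z \<in> open_segment x y"
    then obtain t where t: "0 < t" "t < 1" "z = (1 - t) *\<^sub>R x + t *\<^sub>R y" by (auto simp: in_segment)
    show "x \<in> convex hull {?a, ?b}" by (rule key[OF *(1,2) t *(3)])
    have "z = (1 - (1 - t)) *\<^sub>R y + (1 - t) *\<^sub>R x" using t by simp
    then show "y \<in> convex hull {?a, ?b}" using key[OF *(2,1) _ _ _ *(3), of "1 - t"] t by auto
  qed (use sub in auto)
  moreover have "aff_dim (convex hull {?a, ?b}) = 1"
    using neq by (simp add: aff_dim_convex_hull aff_dim_2)
  ultimately show ?thesis by (simp add: edge_of_def)
qed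

section \<open>Exchanging edges between two graphs\<close>

definition differ :: "'n edges \<Rightarrow> 'n edges \<Rightarrow> 'n edges" where
  "differ G H = (G - H) \<union> (H - G)"

text \<open>This puts edges of \<open>G - H\<close> and of \<open>H - G\<close> on one scale. On
  \<open>differ G H\<close>, exchanging the two graphs just negates it.\<close>

definition agrees :: "'n edges \<Rightarrow> 'n set \<Rightarrow> 'n edges \<Rightarrow> bool" where
  "agrees G e D \<longleftrightarrow> (e \<in> D \<longleftrightarrow> e \<in> G)"

definition swap :: "'n edges \<Rightarrow> 'n edges \<Rightarrow> 'n edges" where
  "swap G P = (G - P) \<union> (P - G)"

text \<open>These are the conditions on the \<open>G\<close> side under which the two characteristic
  imsets keep their sum. The second makes a clique of \<open>G\<close> only survive in exactly one
  new graph, the third excludes cliques belonging to neither old graph.\<close>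

definition half_exchange :: "'n edges \<Rightarrow> 'n edges \<Rightarrow> 'n edges \<Rightarrow> bool" where
  "half_exchange G H P \<longleftrightarrow> chordal (swap G P) \<and>
     (\<forall>S e f. complete_on G S \<longrightarrow> e \<in> G - H \<longrightarrow>
         f \<in> G - H \<longrightarrow> e \<subseteq> S \<longrightarrow> f \<subseteq> S \<longrightarrow>
             e \<in> P \<longrightarrow> f \<in> P) \<and>
     (\<forall>S. complete_on (swap G P) S \<longrightarrow> complete_on G S \<or> complete_on H S)"

definition exchangeable :: "'n edges \<Rightarrow> 'n edges \<Rightarrow> bool" where
  "exchangeable G H \<longleftrightarrow> (\<exists>P. P \<subseteq> differ G H \<and> P \<noteq> {} \<and> P \<noteq> differ G H \<and>
     half_exchange G H P \<and> half_exchange H G P)"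

lemma mem_swap: "e \<in> swap G P \<longleftrightarrow> (e \<in> G) \<noteq> (e \<in> P)"
  by (auto simp: swap_def)

lemma differ_commute: "differ G H = differ H G"
  by (auto simp: differ_def)

lemma exchangeable_commute: "exchangeable G H \<longleftrightarrow> exchangeable H G"
  unfolding exchangeable_def by (auto simp: differ_commute)

text \<open>The edges of \<open>G - H\<close> inside \<open>S\<close> are all in \<open>P\<close> or
  all outside it. In the first case \<open>swap H P\<close> gains all of them, in the second
  \<open>swap G P\<close> keeps all of them.\<close>

lemma half_exchange_one_sided:
  assumes "half_exchange G H P" "P \<subseteq> differ G H" "complete_on G S" "\<not> complete_on H S"
  shows "complete_on (swap G P) S \<longleftrightarrow> \<not> complete_on (swap H P) S"
proof -
  obtain u v where uv: "u \<in> S" "v \<in> S" "u \<noteq> v" "{u, v} \<in> G - H"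
    using assms(3,4) by (auto simp: complete_on_def)
  have cl: "e \<in> P \<longleftrightarrow> {u, v} \<in> P" if "e \<in> G - H" "e \<subseteq> S" for e
    
  proof -
    have uvS: "{u, v} \<subseteq> S" using uv by auto
    have "\<forall>e f. e \<in> G - H \<longrightarrow> f \<in> G - H \<longrightarrow>
        e \<subseteq> S \<longrightarrow> f \<subseteq> S \<longrightarrow> e \<in> P \<longrightarrow> f \<in> P"
      using assms(1,3) unfolding half_exchange_def by blast
    then show ?thesis using uv(4) uvS that by blast
  qed
  show ?thesis
  proof (cases "{u, v} \<in> P")
    case True
    have "complete_on (swap H P) S"
      unfolding complete_on_def
    proof (intro ballI impI)
      fix x y assume xy: "x \<in> S" "y \<in> S" "x \<noteq> y"
      then have "{x, y} \<in> G" using assms(3) by (auto simp: complete_on_def)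
      then show "{x, y} \<in> swap H P"
        using cl[of "{x, y}"] True xy assms(2) by (auto simp: mem_swap differ_def)
    qed
    moreover have "\<not> complete_on (swap G P) S"
      using True uv by (auto simp: complete_on_def mem_swap)
    ultimately show ?thesis by simp
  next
    case False
    have "complete_on (swap G P) S"
      unfolding complete_on_def
    proof (intro ballI impI)
      fix x y assume xy: "x \<in> S" "y \<in> S" "x \<noteq> y"
      then have "{x, y} \<in> G" using assms(3) by (auto simp: complete_on_def)
      then show "{x, y} \<in> swap G P"
        using cl[of "{x, y}"] False xy assms(2) by (auto simp: mem_swap differ_def)
    qed
    moreover have "\<not> complete_on (swap H P) S"
      using False uv by (auto simp: complete_on_def mem_swap)
    ultimately show ?thesis by simp
  qed
qed

lemma exchangeable_rhombus:
  assumes "exchangeable G H" "simple_graph G" "simple_graph H"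
  shows "rhombus_criterion (CGP :: (real ^ (('n::finite) set)) set) (char_imset G) (char_imset H)"
proof -
  from assms(1) obtain P where P: "P \<subseteq> differ G H" "P \<noteq> {}" "P \<noteq> differ G H"
    and hG: "half_exchange G H P" and hH: "half_exchange H G P"
    by (auto simp: exchangeable_def)
  have P': "P \<subseteq> differ H G" using P by (simp add: differ_commute)
  have cG: "chordal (swap G P)" and cH: "chordal (swap H P)" using hG hH by (auto simp: half_exchange_def)
  have "char_imset G $ S + char_imset H $ S = char_imset (swap G P) $ S + char_imset (swap H P) $ S" for S
  proof -
    consider "complete_on G S" "complete_on H S" | "complete_on G S" "\<not> complete_on H S"
      | "\<not> complete_on G S" "complete_on H S" | "\<not> complete_on G S" "\<not> complete_on H S" by blast
    then show ?thesis
    proof cases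
      case 1
      then have "complete_on (swap G P) S" "complete_on (swap H P) S"
        using P(1) by (auto simp: complete_on_def mem_swap differ_def)
      then show ?thesis using 1 by (simp add: char_imset_nth)
    next
      case 2
      then show ?thesis using half_exchange_one_sided[OF hG P(1)] by (auto simp: char_imset_nth)
    next
      case 3
      then show ?thesis using half_exchange_one_sided[OF hH P'] by (auto simp: char_imset_nth)
    next
      case 4
      then show ?thesis using hG hH unfolding half_exchange_def by (auto simp: char_imset_nth)
    qed
  qed
  then have sum: "char_imset G + char_imset H = char_imset (swap G P) + char_imset (swap H P)"
    by (simp add: vec_eq_iff)
  have ne: "swap G P \<noteq> G" "swap G P \<noteq> H" "swap H P \<noteq> G" "swap H P \<noteq> H"
  proof -
    obtain e where e: "e \<in> P" "e \<in> differ G H" using P by blast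
    obtain f where f: "f \<notin> P" "f \<in> differ G H" using P by blast
    show "swap G P \<noteq> G" "swap H P \<noteq> H" using e by (auto simp: set_eq_iff mem_swap)
    show "swap G P \<noteq> H" "swap H P \<noteq> G" using f by (auto simp: set_eq_iff mem_swap differ_def)
  qed
  then have "char_imset (swap G P) \<notin> {char_imset G, char_imset H}"
    "char_imset (swap H P) \<notin> {char_imset G, char_imset H}"
    using char_imset_inject[of "swap G P"] char_imset_inject[of "swap H P"] assms(2,3) cG cH
    by (auto simp: chordal_def)
  then show ?thesis
    unfolding rhombus_criterion_def using char_imset_extreme[OF cG] char_imset_extreme[OF cH] sum by blast
qed

section \<open>The support of the midpoint\<close>

lemma midpoint_weights_nth:
  assumes "midpoint_weights G H w"
  shows "(\<Sum>D\<in>UNIV. w D * char_imset D $ S) = (char_imset G $ S + char_imset H $ S) / 2"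
  using assms by (simp add: midpoint_weights_def)

lemma midpoint_weights_edge:
  assumes "midpoint_weights G H w" "u \<noteq> v"
  shows "(\<Sum>D\<in>UNIV. w D * (if {u, v} \<in> D then 1 else 0)) =
    ((if {u, v} \<in> G then 1 else 0) + (if {u, v} \<in> H then 1 else 0)) / 2"
  using midpoint_weights_nth[OF assms(1), of "{u, v}"] by (simp only: char_imset_edge[OF assms(2)])

text \<open>Complementary slackness: a quantity that is nonnegative on the support and has weighted
  sum 0 vanishes on the support. The lemmas below apply it to various inequalities
  \<open>h\<close>.\<close>

lemma midpoint_weights_zero:
  assumes "midpoint_weights G H w" "(\<Sum>D\<in>UNIV. w D * h D) = 0" "\<And>D. 0 < w D \<Longrightarrow>
      0 \<le> h D" "0 < w D"
  shows "h D = 0"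
proof -
  have "0 \<le> w E * h E" for E
  proof (cases "w E = 0")
    case False
    then have "0 < w E" using assms(1) by (simp add: midpoint_weights_def less_le)
    then show ?thesis using assms(3) by simp
  qed simp
  then have "w D * h D = 0"
    using assms(2) by (subst (asm) sum_nonneg_eq_0_iff) auto
  then show ?thesis using assms(4) by auto
qed

lemma support_clique:
  assumes "D \<in> midpoint_support G H" "complete_on D S"
  shows "complete_on G S \<or> complete_on H S"
proof (rule ccontr)
  assume n: "\<not> (complete_on G S \<or> complete_on H S)"
  obtain w where w: "midpoint_weights G H w" "0 < w D" using assms(1) by (auto simp: midpoint_support_def)
  have "2 \<le> card S"
  proof (rule ccontr)
    assume "\<not> 2 \<le> card S"
    then have "\<forall>u\<in>S. \<forall>v\<in>S. u = v" using card_le_Suc0_iff_eq[of S] by auto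
    then show False using n by (auto simp: complete_on_def)
  qed
  moreover have "char_imset D $ S = 0"
  proof (rule midpoint_weights_zero[OF w(1) _ _ w(2)])
    show "(\<Sum>D\<in>UNIV. w D * char_imset D $ S) = 0"
      using n unfolding midpoint_weights_nth[OF w(1)] by (simp add: char_imset_nth)
  qed (simp add: char_imset_nth)
  ultimately show False using assms(2) by (simp add: char_imset_nth)
qed

lemma support_lower:
  assumes "D \<in> midpoint_support G H" "simple_graph G" "e \<in> G" "e \<in> H"
  shows "e \<in> D"
proof -
  obtain u v where uv: "e = {u, v}" "u \<noteq> v" using assms(2,3) by (meson card_2_iff simple_graph_def)
  obtain w where w: "midpoint_weights G H w" "0 < w D" using assms(1) by (auto simp: midpoint_support_def)
  have "1 - (if {u, v} \<in> D then 1 else (0::real)) = 0"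
  proof (rule midpoint_weights_zero[OF w(1) _ _ w(2)])
    show "(\<Sum>D\<in>UNIV. w D * (1 - (if {u, v} \<in> D then 1 else 0))) = 0"
      unfolding right_diff_distrib sum_subtractf midpoint_weights_edge[OF w(1) uv(2)]
      using w(1) assms(3,4) uv by (simp add: midpoint_weights_def)
  qed simp
  then show ?thesis using uv by (auto split: if_splits)
qed

lemma support_upper:
  assumes "D \<in> midpoint_support G H" "e \<in> D"
  shows "e \<in> G \<or> e \<in> H"
proof -
  have "chordal D" using assms(1) by (force simp: midpoint_support_def midpoint_weights_def)
  then obtain u v where uv: "e = {u, v}" "u \<noteq> v"
    using assms(2) by (meson card_2_iff simple_graph_def chordal_def)
  then have "complete_on D e" using assms(2) by (auto simp: complete_on_def insert_commute)
  then have "complete_on G e \<or> complete_on H e" by (rule support_clique[OF assms(1)])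
  moreover have "u \<in> e" "v \<in> e" using uv by auto
  ultimately show ?thesis using uv unfolding complete_on_def by blast
qed

lemma midpoint_support_commute: "midpoint_support G H = midpoint_support H G"
  by (simp add: midpoint_support_def midpoint_weights_def add.commute)

text \<open>The coordinate of \<open>D\<close> at \<open>S\<close> is at most its coordinate at any
  pair \<open>g\<close> inside \<open>S\<close>. For \<open>g\<close> in \<open>G - H\<close> both
  are 1/2 at the midpoint, so they coincide on the support: one such edge in \<open>D\<close> forces
  all of \<open>S\<close> to be complete in \<open>D\<close>.\<close>

lemma support_closed:
  assumes D: "D \<in> midpoint_support G H" and G: "simple_graph G" and S: "complete_on G S"
    and e: "e \<in> G - H" "e \<subseteq> S" and f: "f \<in> G - H" "f \<subseteq> S" and eD: "e \<in> D"
  shows "f \<in> D"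
proof -
  have main: "(if g \<in> D then 1 else 0) = char_imset D $ S" if "g \<in> G - H" "g \<subseteq> S" for g
  proof -
    obtain u v where uv: "g = {u, v}" "u \<noteq> v" using G \<open>g \<in> G - H\<close>
        by (meson DiffD1 card_2_iff simple_graph_def)
    obtain w where w: "midpoint_weights G H w" "0 < w D" using D by (auto simp: midpoint_support_def)
    have cS: "2 \<le> card S" using that uv card_mono[of S g] by simp
    have nH: "\<not> complete_on H S" using that uv by (auto simp: complete_on_def)
    have "(if {u, v} \<in> D then 1 else 0) - char_imset D $ S = 0"
    proof (rule midpoint_weights_zero[OF w(1) _ _ w(2)])
      show "(\<Sum>D\<in>UNIV. w D * ((if {u, v} \<in> D then 1 else 0) - char_imset D $ S)) = 0"
        unfolding right_diff_distrib sum_subtractf midpoint_weights_edge[OF w(1) uv(2)]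
          midpoint_weights_nth[OF w(1)]
        using S nH cS that uv by (simp add: char_imset_nth)
      show "0 \<le> (if {u, v} \<in> D then 1 else 0) - char_imset D $ S" for D
        using that uv by (auto simp: char_imset_nth complete_on_def)
    qed
    then show ?thesis using uv by simp
  qed
  from main[OF e] main[OF f] eD show ?thesis by (auto split: if_splits)
qed

text \<open>For every edge of \<open>differ G H\<close>, the graphs agreeing with \<open>G\<close>
  on it have total weight 1/2. Of two sets of equal weight, one containing the other, the difference
  has weight 0.\<close>

lemma support_tight:
  assumes D: "D \<in> midpoint_support G H" and simple: "simple_graph G" "simple_graph H"
    and e: "e \<in> differ G H" and f: "f \<in> differ G H"
    and imp: "\<And>D. D \<in> midpoint_support G H \<Longrightarrow> agrees G e D \<Longrightarrow> agrees G f D"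
    and fD: "agrees G f D"
  shows "agrees G e D"
proof -
  obtain w where w: "midpoint_weights G H w" "0 < w D" using D by (auto simp: midpoint_support_def)
  have half: "(\<Sum>D\<in>UNIV. w D * (if agrees G g D then 1 else 0)) = 1 / 2" if g: "g \<in> differ G H" for g
  proof -
    have "card g = 2" using g simple by (auto simp: differ_def simple_graph_def)
    then obtain u v where uv: "g = {u, v}" "u \<noteq> v" by (meson card_2_iff)
    show ?thesis
    proof (cases "g \<in> G")
      case True
      then have "(\<Sum>D\<in>UNIV. w D * (if agrees G g D then 1 else 0)) = (\<Sum>D\<in>UNIV. w D * (if {u, v} \<in> D then 1 else 0))"
        using uv by (auto simp: agrees_def intro!: sum.cong)
      then show ?thesis using True g uv by (simp add: midpoint_weights_edge[OF w(1) uv(2)] differ_def)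
    next
      case False
      then have "(\<Sum>D\<in>UNIV. w D * (if agrees G g D then 1 else 0)) = (\<Sum>D\<in>UNIV. w D - w D * (if {u, v} \<in> D then 1 else 0))"
        using uv by (auto simp: agrees_def intro!: sum.cong)
      then show ?thesis using False g uv w(1)
        by (simp only: sum_subtractf midpoint_weights_edge[OF w(1) uv(2)])
          (simp add: differ_def midpoint_weights_def)
    qed
  qed
  have "(if agrees G f D then 1 else 0) - (if agrees G e D then 1 else (0::real)) = 0"
  proof (rule midpoint_weights_zero[OF w(1) _ _ w(2)])
    show "(\<Sum>D\<in>UNIV. w D * ((if agrees G f D then 1 else 0) - (if agrees G e D then 1 else 0))) = 0"
      unfolding right_diff_distrib sum_subtractf half[OF e] half[OF f] by simp
    fix E assume "0 < w E"
    then have "E \<in> midpoint_support G H" using w(1) by (auto simp: midpoint_support_def)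
    then show "0 \<le> (if agrees G f E then 1 else 0) - (if agrees G e E then 1 else (0::real))"
      using imp[of E] by auto
  qed
  then show ?thesis using fD by (auto split: if_splits)
qed

section \<open>Pairs of split graphs\<close>

definition nbr :: "'n edges \<Rightarrow> 'n \<Rightarrow> 'n set" where
  "nbr G v = {u. {v, u} \<in> G}"

text \<open>
  Within a tight family, the core edges are all switched together with the edges inside the clique
  K. A star edge at v outside K is only tied to the other edges at v.
\<close>

definition core :: "'n edges \<Rightarrow> 'n edges \<Rightarrow> 'n set \<Rightarrow> 'n edges" where
  "core G H K = {e \<in> G - H. e \<subseteq> K \<or> (\<exists>v\<in>e. v \<notin> K \<and> \<not> complete_on H (nbr G v))}"

definition star_edge :: "'n edges \<Rightarrow> 'n edges \<Rightarrow> 'n set \<Rightarrow> 'n \<Rightarrow> 'n \<Rightarrow> bool" where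
  "star_edge G H K v u \<longleftrightarrow> {v, u} \<in> G - H \<and> v \<notin> K \<and> complete_on H (nbr G v)"

text \<open>A star edge whose centre lies in exactly one of the two cliques, directed away from the
  centre. Its head lies in exactly the other clique, so arcs alternate between \<open>L - K\<close>
  and \<open>K - L\<close>.\<close>

definition arc :: "'n edges \<Rightarrow> 'n edges \<Rightarrow> 'n set \<Rightarrow> 'n set \<Rightarrow> 'n \<Rightarrow> 'n \<Rightarrow> bool" where
  "arc G H K L v u \<longleftrightarrow> v \<in> L - K \<and> star_edge G H K v u \<or> v \<in> K - L \<and> star_edge H G L v u"

lemma arc_commute: "arc H G L K = arc G H K L"
  by (intro ext) (auto simp: arc_def)

lemma mem_nbr: "u \<in> nbr G v \<longleftrightarrow> {v, u} \<in> G"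
  by (simp add: nbr_def)

lemma complete_onD: "complete_on G S \<Longrightarrow> u \<in> S \<Longrightarrow> v \<in> S \<Longrightarrow>
    u \<noteq> v \<Longrightarrow> {u, v} \<in> G"
  by (simp add: complete_on_def)

lemma complete_on_closed_nbr:
  assumes "complete_on G (nbr G v)"
  shows "complete_on G (insert v (nbr G v))"
  using assms by (auto simp: complete_on_def mem_nbr insert_commute)

text \<open>
  W abstracts the support of the midpoint. The assumptions are symmetric in G and H, so every
  result is also available, as sym, with the two graphs exchanged.
\<close>

locale split_pair =
  fixes G H :: "('n::finite) edges" and K L :: "'n set" and W :: "'n edges set"
  assumes simple_G: "simple_graph G" and simple_H: "simple_graph H"
    and K_clique: "complete_on G K" and L_clique: "complete_on H L"
    and K_indep: "independent_in G (- K)" and L_indep: "independent_in H (- L)"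
    and W_chordal: "D \<in> W \<Longrightarrow> chordal D"
    and W_lower: "D \<in> W \<Longrightarrow> e \<in> G \<Longrightarrow> e \<in> H \<Longrightarrow> e \<in> D"
    and W_upper: "D \<in> W \<Longrightarrow> e \<in> D \<Longrightarrow> e \<in> G \<or> e \<in> H"
    and W_clique: "D \<in> W \<Longrightarrow> complete_on D S \<Longrightarrow>
        complete_on G S \<or> complete_on H S"
    and W_closed_G: "D \<in> W \<Longrightarrow> complete_on G S \<Longrightarrow>
        e \<in> G - H \<Longrightarrow> e \<subseteq> S \<Longrightarrow> f \<in> G - H \<Longrightarrow>
            f \<subseteq> S \<Longrightarrow> e \<in> D \<Longrightarrow> f \<in> D"
    and W_closed_H: "D \<in> W \<Longrightarrow> complete_on H S \<Longrightarrow>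
        e \<in> H - G \<Longrightarrow> e \<subseteq> S \<Longrightarrow> f \<in> H - G \<Longrightarrow>
            f \<subseteq> S \<Longrightarrow> e \<in> D \<Longrightarrow> f \<in> D"
    and W_tight: "D \<in> W \<Longrightarrow> e \<in> differ G H \<Longrightarrow>
        f \<in> differ G H \<Longrightarrow>
      (\<And>D. D \<in> W \<Longrightarrow> agrees G e D \<Longrightarrow> agrees G f D) \<Longrightarrow>
          agrees G f D \<Longrightarrow> agrees G e D"
begin

lemma agrees_other: "e \<in> differ G H \<Longrightarrow> agrees H e D \<longleftrightarrow> \<not> agrees G e D"
  by (auto simp: agrees_def differ_def)

end

sublocale split_pair \<subseteq> sym: split_pair H G L K W
proof unfold_locales
  fix D e f
  assume "D \<in> W" "e \<in> differ H G" "f \<in> differ H G"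
    and imp: "\<And>D. D \<in> W \<Longrightarrow> agrees H e D \<Longrightarrow> agrees H f D" and fD: "agrees H f D"
  then have ef: "e \<in> differ G H" "f \<in> differ G H" by (simp_all add: differ_commute)
  show "agrees H e D"
    unfolding agrees_other[OF ef(1)]
  proof
    assume e: "agrees G e D"
    have "agrees G f D"
    proof (rule W_tight[OF \<open>D \<in> W\<close> ef(2,1) _ e])
      fix E assume "E \<in> W" "agrees G f E"
      then show "agrees G e E" using imp[of E] agrees_other ef by blast
    qed
    then show False using fD agrees_other ef by blast
  qed
qed (use simple_G simple_H K_clique L_clique K_indep L_indep W_chordal W_lower W_upper W_clique W_closed_G W_closed_H in \<open>blast+\<close>)



section \<open>Adjacency in a split pair and ties within the core\<close>

lemma (in split_pair) loop_G: "{v, v} \<notin> G"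
  using simple_G by (auto simp: simple_graph_def)

lemma (in split_pair) edge_ne: "{u, v} \<in> G \<Longrightarrow> u \<noteq> v"
  using loop_G[of u] by metis

lemma (in split_pair) not_self_nbr: "v \<notin> nbr G v"
  using loop_G[of v] by (simp add: mem_nbr)

lemma (in split_pair) edge_pair:
  assumes "e \<in> G" obtains u v where "e = {u, v}" "u \<noteq> v"
  using assms simple_G by (meson card_2_iff simple_graph_def)

lemma (in split_pair) in_K: "{u, v} \<in> G \<Longrightarrow> u \<notin> K \<Longrightarrow> v \<in> K"
  using K_indep by (auto simp: independent_in_def)

lemma (in split_pair) edge_K: "u \<in> K \<Longrightarrow> v \<in> K \<Longrightarrow>
    u \<noteq> v \<Longrightarrow> {u, v} \<in> G"
  using K_clique by (simp add: complete_on_def)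

lemma (in split_pair) nbr_subset: "v \<notin> K \<Longrightarrow> nbr G v \<subseteq> K"
  using in_K by (auto simp: mem_nbr)

lemma (in split_pair) complete_subset_K: "S \<subseteq> K \<Longrightarrow> complete_on G S"
  using K_clique by (auto simp: complete_on_def)

lemma (in split_pair) nbr_clique: "v \<notin> K \<Longrightarrow> complete_on G (nbr G v)"
  by (intro complete_subset_K nbr_subset)

lemma (in split_pair) chordal_G: "chordal G"
  using split_chordal simple_G K_clique K_indep .

lemma (in split_pair) core_or_star:
  assumes "e \<in> G - H" "e \<notin> core G H K"
  obtains v u where "e = {v, u}" "star_edge G H K v u"
proof -
  obtain v where v: "v \<in> e" "v \<notin> K" "complete_on H (nbr G v)"
    using assms by (auto simp: core_def)
  obtain a b where "e = {a, b}" using edge_pair assms by blast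
  with v(1) obtain u where "e = {v, u}" by (auto simp: insert_commute)
  with that v assms show thesis by (auto simp: star_edge_def)
qed

lemma (in split_pair) star_edge_K: "star_edge G H K v u \<Longrightarrow> u \<in> K"
  using in_K by (auto simp: star_edge_def)

lemma (in split_pair) star_edge_not_core:
  assumes "star_edge G H K v u" shows "{v, u} \<notin> core G H K"
  using assms star_edge_K[OF assms] by (auto simp: core_def star_edge_def)

lemma (in split_pair) nbr_outside_L:
  assumes "complete_on H (nbr G v)" "x \<in> nbr G v" "y \<in> nbr G v" "x \<notin> L" "y \<notin> L"
  shows "x = y"
  using assms sym.in_K[of x y] complete_onD by metis

text \<open>If \<open>nbr G v\<close> is not a clique of \<open>H\<close>, it contains a pair
  missing in \<open>H\<close>. That pair lies in \<open>K\<close>, and the clique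
  \<open>insert v (nbr G v)\<close> of \<open>G\<close> ties it to every edge of
  \<open>G - H\<close> at \<open>v\<close>.\<close>

lemma (in split_pair) core_basis:
  assumes "e \<in> core G H K"
  obtains f where "f \<in> G - H" "f \<subseteq> K" "\<And>D. D \<in> W \<Longrightarrow>
      e \<in> D \<longleftrightarrow> f \<in> D"
proof (cases "e \<subseteq> K")
  case True
  then show ?thesis using that[of e] assms by (auto simp: core_def)
next
  case False
  then obtain v where v: "v \<in> e" "v \<notin> K" "\<not> complete_on H (nbr G v)"
    using assms by (auto simp: core_def)
  obtain a b where "e = {a, b}" using edge_pair[of e] assms unfolding core_def by blast
  with v(1) obtain u where u: "e = {v, u}" by (auto simp: insert_commute)
  have eG: "e \<in> G - H" using assms by (simp add: core_def)
  obtain x y where xy: "x \<in> nbr G v" "y \<in> nbr G v" "x \<noteq> y" "{x, y} \<notin> H"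
    using v(3) by (auto simp: complete_on_def)
  then have f: "{x, y} \<in> G - H" "{x, y} \<subseteq> K"
    using nbr_subset[OF v(2)] edge_K by auto
  have cl: "complete_on G (insert v (nbr G v))" by (intro complete_on_closed_nbr nbr_clique v)
  have sub: "e \<subseteq> insert v (nbr G v)" "{x, y} \<subseteq> insert v (nbr G v)"
    using u eG xy by (auto simp: mem_nbr)
  show ?thesis
    by (rule that[OF f]) (meson W_closed_G cl sub eG f)
qed

lemma (in split_pair) core_agree:
  assumes "D \<in> W" "e \<in> core G H K" "f \<in> core G H K"
  shows "e \<in> D \<longleftrightarrow> f \<in> D"
proof -
  obtain e' where e': "e' \<in> G - H" "e' \<subseteq> K" "\<And>D. D \<in> W \<Longrightarrow>
      e \<in> D \<longleftrightarrow> e' \<in> D"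
    using core_basis[OF assms(2)] by blast
  obtain f' where f': "f' \<in> G - H" "f' \<subseteq> K" "\<And>D. D \<in> W \<Longrightarrow>
      f \<in> D \<longleftrightarrow> f' \<in> D"
    using core_basis[OF assms(3)] by blast
  show ?thesis using W_closed_G[OF assms(1) K_clique] e' f' assms(1) by blast
qed

lemma (in split_pair) core_in_clique:
  assumes "core G H K \<noteq> {}"
  obtains e where "e \<in> G - H" "e \<subseteq> K"
  using assms core_basis by blast

lemma (in split_pair) edge_in_K_core: "{u, v} \<in> G \<Longrightarrow> {u, v} \<notin> H \<Longrightarrow>
    u \<in> K \<Longrightarrow> v \<in> K \<Longrightarrow> {u, v} \<in> core G H K"
  by (simp add: core_def)

section \<open>Arcs as a directed graph of out-degree at most one\<close>

lemma (in split_pair) arc_cases: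
  assumes "arc G H K L v u"
  shows "v \<in> L \<and> v \<notin> K \<and> u \<in> K \<and> u \<notin> L \<and> {v, u} \<in> G \<and> {v, u} \<notin> H \<and> complete_on H (nbr G v) \<or>
         v \<in> K \<and> v \<notin> L \<and> u \<in> L \<and> u \<notin> K \<and> {v, u} \<in> H \<and> {v, u} \<notin> G \<and> complete_on G (nbr H v)"
proof -
  have "star_edge G H K v u \<Longrightarrow> v \<in> L \<Longrightarrow> u \<notin> L"
    using sym.edge_K[of v u] edge_ne[of v u] by (auto simp: star_edge_def)
  moreover have "star_edge H G L v u \<Longrightarrow> v \<in> K \<Longrightarrow> u \<notin> K"
    using edge_K[of v u] sym.edge_ne[of v u] by (auto simp: star_edge_def)
  ultimately show ?thesis
    using assms star_edge_K[of v u] sym.star_edge_K[of v u] by (auto simp: arc_def star_edge_def)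
qed

lemma (in split_pair) arc_nbr_G:
  assumes "arc G H K L v u" "v \<notin> K" "x \<in> nbr G v" "x \<notin> L"
  shows "x = u"
  using arc_cases[OF assms(1)] assms nbr_outside_L[of v x u] by (auto simp: mem_nbr)

lemma (in split_pair) arc_sym: "arc H G L K = arc G H K L"
  by (rule arc_commute)

lemma (in split_pair) arc_nbr_H:
  assumes "arc G H K L v u" "v \<notin> L" "x \<in> nbr H v" "x \<notin> K"
  shows "x = u"
  using sym.arc_nbr_G[unfolded arc_sym, OF assms] .

text \<open>For \<open>v\<close> in \<open>L - K\<close>, the neighbourhood in \<open>G\<close> is a
  clique of \<open>H\<close>, while \<open>H\<close> has no edge outside \<open>L\<close>; so only
  one neighbour can lie outside \<open>L\<close>. The other case is symmetric.\<close>

lemma (in split_pair) arc_unique: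
  assumes "arc G H K L v u" "arc G H K L v u'"
  shows "u = u'"
proof (cases "v \<in> K")
  case False
  then have "u' \<in> nbr G v" "u' \<notin> L" using arc_cases[OF assms(2)] by (auto simp: mem_nbr)
  then show ?thesis using arc_nbr_G[OF assms(1) False] by blast
next
  case True
  then have "v \<notin> L" "u' \<in> nbr H v" "u' \<notin> K" using arc_cases[OF assms(2)] by (auto simp: mem_nbr)
  then show ?thesis using arc_nbr_H[OF assms(1)] by blast
qed

section \<open>Explicit exchanges\<close>

lemma (in split_pair) arc_not_core:
  assumes "arc G H K L v u"
  shows "{v, u} \<in> differ G H" "{v, u} \<notin> core G H K" "{v, u} \<notin> core H G L"
  using assms star_edge_not_core[of v u] sym.star_edge_not_core[of v u]
  by (auto simp: arc_def star_edge_def differ_def core_def)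

text \<open>Every arc joins \<open>K\<close> to its complement, so the new graph is still split with
  clique \<open>K\<close>. A new clique contains an added edge from some \<open>a\<close> to
  \<open>b = p a\<close>. The assumptions \<open>nL\<close> and \<open>nnL\<close> make its other
  vertices neighbours of \<open>a\<close> in \<open>H\<close> that lie in \<open>L\<close>: a
  neighbour of \<open>b\<close> outside \<open>L\<close> would be cut off by the removal of the arc
  leaving \<open>b\<close>, and injectivity excludes a second added edge at
  \<open>b\<close>.\<close>

lemma (in split_pair) arc_swap_half:
  assumes arcs: "\<And>v. v \<in> X \<Longrightarrow> arc G H K L v (p v)" and inj: "inj_on p X"
    and nL: "\<And>v. v \<in> X \<Longrightarrow> v \<in> K \<Longrightarrow>
        nbr G (p v) \<inter> L \<subseteq> nbr H v"
    and nnL: "\<And>v x. v \<in> X \<Longrightarrow> v \<in> K \<Longrightarrow>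
        x \<in> nbr G (p v) \<Longrightarrow> x \<notin> L \<Longrightarrow> p v \<in> X \<and> p (p v) = x"
  shows "half_exchange G H ((\<lambda>v. {v, p v}) ` X)"
proof -
  let ?P = "(\<lambda>v. {v, p v}) ` X"
  note ac = arc_cases[OF arcs]
  have P_card: "card e = 2" if eP: "e \<in> ?P" for e
  proof -
    obtain v where v: "v \<in> X" "e = {v, p v}" using eP by blast
    then have "v \<noteq> p v" using ac[OF v(1)] by metis
    then show ?thesis using v by simp
  qed
  have simp: "simple_graph (swap G ?P)"
    using simple_G P_card by (auto simp: simple_graph_def swap_def)
  have cK: "complete_on (swap G ?P) K"
    unfolding complete_on_def
  proof (intro ballI impI)
    fix u v assume uv: "u \<in> K" "v \<in> K" "u \<noteq> v"
    have "{u, v} \<notin> ?P"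
    proof
      assume "{u, v} \<in> ?P"
      then obtain w where w: "w \<in> X" "{u, v} = {w, p w}" by blast
      then have "w \<in> {u, v}" "p w \<in> {u, v}" by auto
      then show False using uv ac[OF w(1)] by auto
    qed
    then show "{u, v} \<in> swap G ?P" using edge_K[OF uv] by (simp add: mem_swap)
  qed
  have ind: "independent_in (swap G ?P) (- K)"
    unfolding independent_in_def
  proof (intro ballI)
    fix u v assume uv: "u \<in> - K" "v \<in> - K"
    have "{u, v} \<notin> ?P"
    proof
      assume "{u, v} \<in> ?P"
      then obtain w where w: "w \<in> X" "{u, v} = {w, p w}" by blast
      then have "w \<in> {u, v}" "p w \<in> {u, v}" by auto
      then show False using uv ac[OF w(1)] by auto
    qed
    then show "{u, v} \<notin> swap G ?P" using in_K uv by (auto simp: mem_swap)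
  qed
  have "f \<in> ?P" if S: "complete_on G S" and e: "e \<in> G - H" "e \<subseteq> S" "e \<in> ?P"
      and f: "f \<in> G - H" "f \<subseteq> S" for S e f
  proof -
    \<comment> \<open>An edge of \<open>P\<close> in \<open>G - H\<close> is an arc with tail
      \<open>b\<close> outside \<open>K\<close>. Since \<open>nbr G b\<close> is a clique of
      \<open>H\<close>, every edge of \<open>G - H\<close> in \<open>S\<close> meets
      \<open>b\<close>, and by uniqueness of arcs it is this arc.\<close>
    obtain b where b: "b \<in> X" "e = {b, p b}" using e by blast
    then have b': "b \<notin> K" "b \<in> S" and cb: "complete_on H (nbr G b)" using ac[of b] e by auto
    have Sb: "x \<in> nbr G b" if "x \<in> S" "x \<noteq> b" for x
      using complete_onD[OF S b'(2) that(1)] that by (auto simp: mem_nbr)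
    obtain x y where xy: "f = {x, y}" "x \<noteq> y" using edge_pair f by blast
    have "b \<in> f"
    proof (rule ccontr)
      assume "b \<notin> f"
      then have "x \<in> nbr G b" "y \<in> nbr G b" using Sb xy f by auto
      then show False using complete_onD[OF cb] xy f by auto
    qed
    then obtain z where z: "f = {b, z}" using xy by (auto simp: insert_commute)
    then have "z \<notin> L" using f ac[OF b(1)] b' sym.edge_K[of b z] edge_ne[of b z] by auto
    moreover have "z \<in> nbr G b" using z f by (simp add: mem_nbr)
    ultimately have "z = p b" using arc_nbr_G[OF arcs[OF b(1)] b'(1)] by blast
    then show ?thesis using z b by auto
  qed
  moreover have "complete_on H S" if S: "complete_on (swap G ?P) S" and nG: "\<not> complete_on G S" for S
  proof -
    obtain u v where uv: "u \<in> S" "v \<in> S" "u \<noteq> v" "{u, v} \<notin> G" using nG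
        by (auto simp: complete_on_def)
    then have "{u, v} \<in> ?P" using complete_onD[OF S] by (auto simp: mem_swap)
    then obtain a where a: "a \<in> X" "{u, v} = {a, p a}" by blast
    define b where "b = p a"
    have aS: "a \<in> S" "b \<in> S" using a uv unfolding b_def by (auto simp: doubleton_eq_iff)
    have ab: "a \<in> K" "a \<notin> L" "b \<in> L" "b \<notin> K" "{a, b} \<in> H"
      using ac[OF a(1)] uv a unfolding b_def by auto
    have other: "x \<in> L \<and> {a, x} \<in> H" if x: "x \<in> S" "x \<noteq> a" "x \<noteq> b" for x
    proof -
      have e: "{b, x} \<in> swap G ?P" using complete_onD[OF S aS(2) x(1)] x by auto
      have xK: "x \<in> K" using e ind ab by (auto simp: independent_in_def)
      show ?thesis
      proof (cases "{b, x} \<in> G")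
        case True
        then have nb: "{b, x} \<notin> ?P" using e by (simp add: mem_swap)
        have xb: "x \<in> nbr G (p a)" using True by (simp add: mem_nbr b_def)
        have "x \<in> L"
        proof (rule ccontr)
          assume "x \<notin> L"
          then have "b \<in> X" "p b = x" using nnL[OF a(1) ab(1) xb] by (auto simp: b_def)
          then show False using nb by auto
        qed
        then show ?thesis using nL[OF a(1) ab(1)] xb by (auto simp: mem_nbr)
      next
        case False
        then have "{b, x} \<in> ?P" using e by (simp add: mem_swap)
        then obtain v where v: "v \<in> X" "{b, x} = {v, p v}" by blast
        then consider "v = b" "p v = x" | "v = x" "p v = b" by (auto simp: doubleton_eq_iff)
        then show ?thesis
        proof cases
          case 1 then show ?thesis using ac[OF v(1)] False ab by auto
        next
          case 2 then show ?thesis using inj a(1) v(1) x by (auto simp: inj_on_def b_def)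
        qed
      qed
    qed
    show ?thesis
      unfolding complete_on_def
    proof (intro ballI impI)
      fix x y assume xy: "x \<in> S" "y \<in> S" "x \<noteq> y"
      show "{x, y} \<in> H"
        using other[OF xy(1)] other[OF xy(2)] ab xy sym.edge_K[of x y]
        by (cases "x = a"; cases "y = a"; cases "x = b"; cases "y = b") (auto simp: insert_commute)
    qed
  qed
  ultimately show ?thesis
    unfolding half_exchange_def using split_chordal[OF simp cK ind] by blast
qed

lemma (in split_pair) arc_swap:
  assumes ne: "X \<noteq> {}" and arcs: "\<And>v. v \<in> X \<Longrightarrow> arc G H K L v (p v)"
      and inj: "inj_on p X"
    and "\<And>v. v \<in> X \<Longrightarrow> v \<in> K \<Longrightarrow> nbr G (p v) \<inter> L \<subseteq> nbr H v"
    and "\<And>v x. v \<in> X \<Longrightarrow> v \<in> K \<Longrightarrow>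
        x \<in> nbr G (p v) \<Longrightarrow> x \<notin> L \<Longrightarrow> p v \<in> X \<and> p (p v) = x"
    and "\<And>v. v \<in> X \<Longrightarrow> v \<in> L \<Longrightarrow> nbr H (p v) \<inter> K \<subseteq> nbr G v"
    and "\<And>v x. v \<in> X \<Longrightarrow> v \<in> L \<Longrightarrow>
        x \<in> nbr H (p v) \<Longrightarrow> x \<notin> K \<Longrightarrow> p v \<in> X \<and> p (p v) = x"
    and core: "core G H K \<union> core H G L \<noteq> {}"
  shows "exchangeable G H"
proof -
  let ?P = "(\<lambda>v. {v, p v}) ` X"
  have "half_exchange G H ?P" by (rule arc_swap_half) (use assms in blast)+
  moreover have "half_exchange H G ?P"
    by (rule sym.arc_swap_half[unfolded arc_sym]) (use assms in blast)+
  moreover obtain e where "e \<in> core G H K \<union> core H G L" using core by blast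
  then have "e \<in> differ G H" "e \<notin> ?P" using arc_not_core[OF arcs] by (auto simp: core_def differ_def)
  moreover have "?P \<subseteq> differ G H" using arc_not_core(1)[OF arcs] by auto
  ultimately show ?thesis unfolding exchangeable_def using ne by blast
qed

text \<open>The swap gives \<open>v\<close> its neighbourhood in \<open>H\<close> and changes
  nothing else. This neighbourhood is a clique of \<open>G\<close>, so \<open>v\<close> is
  simplicial in the new graph, and cliques through \<open>v\<close> lie in its closed neighbourhood
  in \<open>H\<close>.\<close>

lemma (in split_pair) vertex_swap_half:
  assumes v: "v \<notin> K" "v \<notin> L" and HG: "complete_on H (nbr G v)" and GH: "complete_on G (nbr H v)"
  shows "half_exchange G H {e \<in> differ G H. v \<in> e}"
proof -
  let ?P = "{e \<in> differ G H. v \<in> e}"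
  have at: "e \<in> swap G ?P \<longleftrightarrow> e \<in> H" if "v \<in> e" for e using that
      by (auto simp: mem_swap differ_def)
  have off: "e \<in> swap G ?P \<longleftrightarrow> e \<in> G" if "v \<notin> e" for e using that
      by (auto simp: mem_swap)
  have "chordal (swap G ?P)"
  proof (rule chordal_elimination[where X = "- {v}"])
    show "simple_graph (swap G ?P)"       unfolding simple_graph_def
    proof
      fix e assume "e \<in> swap G ?P"
      then have "e \<in> G \<or> e \<in> H" using at[of e] off[of e] by blast
      then show "card e = 2" using simple_G simple_H by (auto simp: simple_graph_def)
    qed
    have "restrict_graph (swap G ?P) (- {v}) = restrict_graph G (- {v})"
      using off by (auto simp: restrict_graph_def)
    then show "chordal (restrict_graph (swap G ?P) (- {v}))"
      using chordal_restrict[OF chordal_G] by simp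
    fix Y assume Y: "Y \<noteq> {}" "Y \<inter> - {v} = {}"
    have nb: "{x, y} \<in> swap G ?P" if xy: "x \<noteq> y" "{v, x} \<in> swap G ?P" "{v, y} \<in> swap G ?P" for x y
    proof -
      have "x \<in> nbr H v" "y \<in> nbr H v" using xy at by (auto simp: mem_nbr)
      moreover have "x \<noteq> v" "y \<noteq> v" using calculation sym.not_self_nbr by auto
      ultimately show ?thesis using complete_onD[OF GH] xy off by auto
    qed
    then show "\<exists>u\<in>Y. \<forall>x\<in>- {v} \<union> Y. \<forall>y\<in>- {v} \<union> Y. x \<noteq> y \<longrightarrow> {u, x} \<in> swap G ?P \<longrightarrow> {u, y} \<in> swap G ?P \<longrightarrow> {x, y} \<in> swap G ?P"
    proof (intro bexI[of _ v] ballI impI)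
      show "v \<in> Y" using Y by blast
    qed (rule nb)
  qed
  moreover have "f \<in> ?P" if S: "complete_on G S" and e: "e \<subseteq> S" "e \<in> ?P"
      and f: "f \<in> G - H" "f \<subseteq> S" for S e f
  proof -
    have vS: "v \<in> S" using e by auto
    obtain x y where xy: "f = {x, y}" "x \<noteq> y" using edge_pair f by blast
    have "v \<in> f"
    proof (rule ccontr)
      assume "v \<notin> f"
      then have "x \<in> nbr G v" "y \<in> nbr G v"
        using complete_onD[OF S vS, of x] complete_onD[OF S vS, of y] xy f by (auto simp: mem_nbr)
      then show False using complete_onD[OF HG] xy f by auto
    qed
    then show ?thesis using f by (auto simp: differ_def)
  qed
  moreover have "complete_on G S \<or> complete_on H S" if S: "complete_on (swap G ?P) S" for S
  proof (cases "v \<in> S")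
    case False
    have "{x, y} \<in> G" if "x \<in> S" "y \<in> S" "x \<noteq> y" for x y
      using complete_onD[OF S that] off[of "{x, y}"] that False by blast
    then show ?thesis by (simp add: complete_on_def)
  next
    case True
    have "S \<subseteq> insert v (nbr H v)"
    proof
      fix x assume "x \<in> S"
      then show "x \<in> insert v (nbr H v)"
        using complete_onD[OF S True, of x] at[of "{v, x}"] by (cases "x = v") (auto simp: mem_nbr)
    qed
    moreover have "complete_on H (insert v (nbr H v))"
      by (intro complete_on_closed_nbr sym.nbr_clique v)
    ultimately show ?thesis by (auto simp: complete_on_def)
  qed
  ultimately show ?thesis unfolding half_exchange_def by blast
qed

lemma (in split_pair) vertex_swap:
  assumes v: "v \<notin> K" "v \<notin> L" "complete_on H (nbr G v)" "complete_on G (nbr H v)"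
    and ne: "nbr G v \<noteq> nbr H v" and e: "e \<in> differ G H" "v \<notin> e"
  shows "exchangeable G H"
proof -
  let ?P = "{e \<in> differ G H. v \<in> e}"
  have "half_exchange G H ?P" by (rule vertex_swap_half[OF v])
  moreover have "half_exchange H G ?P"
    using sym.vertex_swap_half[OF v(2,1,4,3)] by (simp add: differ_commute)
  moreover obtain u where "(u \<in> nbr G v) \<noteq> (u \<in> nbr H v)" using ne by blast
  then have "{v, u} \<in> ?P" by (auto simp: mem_nbr differ_def)
  then have "?P \<noteq> {}" by blast
  moreover have "?P \<noteq> differ G H" "?P \<subseteq> differ G H" using e by blast+
  ultimately show ?thesis unfolding exchangeable_def by (intro exI[of _ ?P]) simp
qed

text \<open>A single edge moves from \<open>H\<close> to \<open>G\<close>. Both of its ends lie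
  outside \<open>K\<close>, so splitness of \<open>G\<close> with clique \<open>K\<close> is lost;
  \<open>nested\<close> restores chordality and \<open>common\<close> keeps new cliques inside the
  closed neighbourhood of \<open>i\<close> in \<open>H\<close>.\<close>

lemma (in split_pair) pendant_swap:
  assumes i: "i \<notin> K" "i \<notin> L" and b: "b \<in> L" "b \<notin> K"
    and nbrs: "nbr H i - nbr G i = {b}" and cl: "complete_on G (nbr H i)"
    and common: "nbr G i \<inter> nbr G b \<subseteq> nbr H i"
    and nested: "nbr G b \<subseteq> nbr G i \<or> nbr G i \<subseteq> nbr G b"
    and core: "e \<in> differ G H" "e \<noteq> {i, b}"
  shows "exchangeable G H"
proof -
  have ib: "{i, b} \<in> H - G" using nbrs by (auto simp: mem_nbr)
  have inb: "i \<noteq> b" using i b by auto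
  have sG: "swap G {{i, b}} = insert {i, b} G" and sH: "swap H {{i, b}} = H - {{i, b}}"
    using ib by (auto simp: swap_def)
  let ?D = "insert {i, b} G"
  have simple_D: "simple_graph ?D" using simple_G inb by (auto simp: simple_graph_def)
  \<comment> \<open>the end of the new edge with the smaller neighbourhood is simplicial\<close>
  have chordal_insert: "chordal ?D" if uv: "{u, v} = {i, b}" "nbr G u \<subseteq> nbr G v" for u v
  proof (rule chordal_elimination[where X = "- {u}"])
    have "restrict_graph ?D (- {u}) = restrict_graph G (- {u})"
      using uv by (auto simp: restrict_graph_def)
    then show "chordal (restrict_graph ?D (- {u}))" using chordal_restrict[OF chordal_G] by simp
    have u: "u \<notin> K" using uv i b by (auto simp: doubleton_eq_iff)
    have nb: "{x, y} \<in> ?D" if xy: "x \<noteq> y" "{u, x} \<in> ?D" "{u, y} \<in> ?D" for x y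
    proof -
      have "x = v \<or> x \<in> nbr G u" "y = v \<or> y \<in> nbr G u"
        using xy uv by (auto simp: mem_nbr doubleton_eq_iff)
      then show ?thesis
        using xy(1) complete_onD[OF nbr_clique[OF u], of x y] uv(2) by (auto simp: mem_nbr insert_commute)
    qed
    then show "\<exists>w\<in>Y. \<forall>x\<in>- {u} \<union> Y. \<forall>y\<in>- {u} \<union> Y. x \<noteq> y \<longrightarrow> {w, x} \<in> ?D \<longrightarrow> {w, y} \<in> ?D \<longrightarrow> {x, y} \<in> ?D"
      if Y: "Y \<noteq> {}" "Y \<inter> - {u} = {}" for Y
    proof (intro bexI[of _ u] ballI impI)
      show "u \<in> Y" using Y by blast
    qed (rule nb)
  qed (rule simple_D)
  have chG: "chordal ?D" using nested chordal_insert[of b i] chordal_insert[of i b] by (auto simp: insert_commute)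
  have clique: "complete_on G S \<or> complete_on H S" if S: "complete_on ?D S" for S
  proof (cases "i \<in> S \<and> b \<in> S")
    case False
    then have "complete_on G S" using S by (auto simp: complete_on_def doubleton_eq_iff)
    then show ?thesis ..
  next
    case True
    have "x \<in> insert i (nbr H i)" if "x \<in> S" for x
    proof (cases "x = i \<or> x = b")
      case True then show ?thesis using ib by (auto simp: mem_nbr)
    next
      case False
      then have "x \<in> nbr G i \<inter> nbr G b"
        using complete_onD[OF S _ that, of i] complete_onD[OF S _ that, of b] True
        by (auto simp: mem_nbr doubleton_eq_iff)
      then show ?thesis using common by blast
    qed
    moreover have "complete_on H (insert i (nbr H i))"
      by (intro complete_on_closed_nbr sym.nbr_clique i)
    ultimately show ?thesis by (auto simp: complete_on_def)
  qed
  have halfG: "half_exchange G H {{i, b}}"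
    unfolding half_exchange_def sG using chG clique ib by blast
  have chH: "chordal (H - {{i, b}})"
  proof (rule split_chordal[where K = L])
    show "simple_graph (H - {{i, b}})" using simple_H by (auto simp: simple_graph_def)
    show "complete_on (H - {{i, b}}) L"
      using sym.edge_K i by (auto simp: complete_on_def doubleton_eq_iff)
    show "independent_in (H - {{i, b}}) (- L)" using L_indep by (auto simp: independent_in_def)
  qed
  have closed: "f = {i, b}" if S: "complete_on H S" and f: "f \<in> H - G" "f \<subseteq> S"
      and ibS: "{i, b} \<subseteq> S" for S f
  proof -
    obtain x y where xy: "f = {x, y}" "x \<noteq> y" using sym.edge_pair f by blast
    have "i \<in> f"
    proof (rule ccontr)
      assume "i \<notin> f"
      then have "x \<in> nbr H i" "y \<in> nbr H i"
        using complete_onD[OF S, of i x] complete_onD[OF S, of i y] ibS xy f by (auto simp: mem_nbr)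
      then show False using complete_onD[OF cl] xy f by auto
    qed
    then obtain z where z: "f = {i, z}" using xy by (auto simp: insert_commute)
    then have "z \<in> nbr H i - nbr G i" using f by (auto simp: mem_nbr)
    then show ?thesis using nbrs z by auto
  qed
  have "half_exchange H G {{i, b}}"
    unfolding half_exchange_def sH
  proof (intro conjI allI impI chH)
    fix S e f assume "complete_on H S" "e \<in> H - G" "f \<in> H - G" "e \<subseteq> S" "f \<subseteq> S"
        "e \<in> {{i, b}}"
    then show "f \<in> {{i, b}}" using closed[of S f] by auto
  qed (auto simp: complete_on_def)
  then show ?thesis
    unfolding exchangeable_def using halfG ib core by (intro exI[of _ "{{i, b}}"]) (auto simp: differ_def)
qed


text \<open>When every vertex of \<open>Y\<close> is hit by an arc from \<open>Y\<close>, counting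
  makes \<open>p\<close> a permutation of \<open>Y\<close>. Then the arc forced at each head is
  already among those exchanged, and no looseness is required.\<close>

lemma (in split_pair) arc_cycle_swap:
  assumes ne: "Y \<noteq> {}" and arcs: "\<And>v. v \<in> Y \<Longrightarrow> arc G H K L v (p v)"
      and cyc: "Y \<subseteq> p ` Y"
    and core: "core G H K \<union> core H G L \<noteq> {}"
  shows "exchangeable G H"
proof -
  note ac = arc_cases[OF arcs]
  have fin: "finite Y" by simp
  have "card (p ` Y) \<le> card Y" by (rule card_image_le[OF fin])
  then have pY: "p ` Y = Y" using card_seteq[of "p ` Y" Y] cyc fin by auto
  have inj: "inj_on p Y" by (rule eq_card_imp_inj_on[OF fin]) (simp add: pY)
  \<comment> \<open>The neighbours in both cliques, taken in the graph that contains the arc at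
    \<open>v\<close>. Along an arc they can only grow: \<open>p v\<close> and these vertices share a
    neighbourhood that is a clique of the opposite graph.\<close>
  define C where "C v = (if v \<in> K then nbr H v else nbr G v) \<inter> K \<inter> L" for v
  have mono: "C v \<subseteq> C (p v)" if v: "v \<in> Y" for v
  proof
    fix x assume x: "x \<in> C v"
    then have xKL: "x \<in> K" "x \<in> L" by (auto simp: C_def)
    show "x \<in> C (p v)"
    proof (cases "v \<in> K")
      case True
      then have "x \<in> nbr H v" "p v \<in> nbr H v" "complete_on G (nbr H v)" "p v \<notin> K"
        using ac[OF v] x by (auto simp: C_def mem_nbr)
      moreover have "p v \<noteq> x" using calculation xKL by blast
      ultimately have "{p v, x} \<in> G" using complete_onD by metis
      then show ?thesis using \<open>p v \<notin> K\<close> xKL by (simp add: C_def mem_nbr)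
    next
      case False
      then have "x \<in> nbr G v" "p v \<in> nbr G v" "complete_on H (nbr G v)" "p v \<in> K" "p v \<notin> L"
        using ac[OF v] x by (auto simp: C_def mem_nbr)
      moreover have "p v \<noteq> x" using calculation xKL by blast
      ultimately have "{p v, x} \<in> H" using complete_onD by metis
      then show ?thesis using \<open>p v \<in> K\<close> xKL by (simp add: C_def mem_nbr)
    qed
  qed
  \<comment> \<open>p permutes Y, so these inclusions are equalities\<close>
  have eq: "C (p v) = C v" if v: "v \<in> Y" for v
  proof (rule ccontr)
    assume "C (p v) \<noteq> C v"
    then have "C v \<subset> C (p v)" using mono[OF v] by auto
    then have "card (C v) < card (C (p v))" by (intro psubset_card_mono) auto
    moreover have "card (C w) \<le> card (C (p w))" if "w \<in> Y" for w
      using mono[OF that] by (intro card_mono) auto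
    ultimately have "(\<Sum>w\<in>Y. card (C w)) < (\<Sum>w\<in>Y. card (C (p w)))"
      using v fin by (intro sum_strict_mono_ex1) auto
    also have "\<dots> = (\<Sum>w\<in>p ` Y. card (C w))" using inj by (simp add: sum.reindex)
    finally show False by (simp add: pY)
  qed
  show ?thesis
  proof (rule arc_swap[OF ne arcs inj _ _ _ _ core])
    fix v assume v: "v \<in> Y" "v \<in> K"
    have pv: "p v \<in> Y" "p v \<notin> K" using ac[OF v(1)] v pY by auto
    have "nbr G (p v) \<inter> L = C (p v)" using nbr_subset[OF pv(2)] pv by (auto simp: C_def)
    then show "nbr G (p v) \<inter> L \<subseteq> nbr H v" using eq[OF v(1)] v by (auto simp: C_def)
    show "p v \<in> Y \<and> p (p v) = x" if "x \<in> nbr G (p v)" "x \<notin> L" for x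
      using arc_nbr_G[OF arcs[OF pv(1)] pv(2) that] pv by blast
  next
    fix v assume v: "v \<in> Y" "v \<in> L"
    have pv: "p v \<in> Y" "p v \<notin> L" "p v \<in> K" "v \<notin> K" using ac[OF v(1)] v pY by auto
    have "nbr H (p v) \<inter> K = C (p v)" using sym.nbr_subset[OF pv(2)] pv by (auto simp: C_def)
    then show "nbr H (p v) \<inter> K \<subseteq> nbr G v" using eq[OF v(1)] v pv by (auto simp: C_def)
    show "p v \<in> Y \<and> p (p v) = x" if "x \<in> nbr H (p v)" "x \<notin> K" for x
      using arc_nbr_H[OF arcs[OF pv(1)] pv(2) that] pv by blast
  qed
qed

section \<open>Linked cores\<close>

text \<open>
  When all core edges agree with G simultaneously on W, one of them, r, represents them all.
\<close>

definition loose :: "'n edges \<Rightarrow> 'n edges \<Rightarrow> 'n edges set \<Rightarrow> 'n set \<Rightarrow> 'n set \<Rightarrow> bool" where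
  "loose G H W r e \<longleftrightarrow> e \<in> differ G H \<and> (\<exists>D\<in>W. agrees G e D \<noteq> agrees G r D)"

locale linked_cores = split_pair +
  fixes r
  assumes r: "r \<in> core G H K \<union> core H G L"
    and linked: "D \<in> W \<Longrightarrow> e \<in> core G H K \<union> core H G L \<Longrightarrow>
        agrees G e D \<longleftrightarrow> agrees G r D"
begin

lemma core_differ: "core G H K \<union> core H G L \<subseteq> differ G H"
  by (auto simp: core_def differ_def)

lemma r_differ: "r \<in> differ G H"
  using r core_differ by blast

lemma loose_sym: "loose H G W r = loose G H W r"
proof
  fix e
  have "agrees H e D \<noteq> agrees H r D \<longleftrightarrow> agrees G e D \<noteq> agrees G r D" if "e \<in> differ G H" for D
    using agrees_other[OF that] agrees_other[OF r_differ] by simp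
  then show "loose H G W r e = loose G H W r e"
    unfolding loose_def differ_commute[of H G] by blast
qed

end

sublocale linked_cores \<subseteq> sym: linked_cores H G L K W r
proof unfold_locales
  show "r \<in> core H G L \<union> core G H K" using r by blast
  fix D e assume "D \<in> W" "e \<in> core H G L \<union> core G H K"
  then show "agrees H e D \<longleftrightarrow> agrees H r D"
    using linked[of D e] agrees_other core_differ r_differ by blast
qed

section \<open>Exchanging loose edges\<close>

lemma (in linked_cores) loose_not_core: "loose G H W r e \<Longrightarrow> e \<notin> core G H K \<union> core H G L"
  using linked unfolding loose_def by blast

text \<open>If agreement on \<open>r\<close> implied agreement on \<open>e\<close> throughout
  \<open>W\<close>, tightness would make the two equivalent and \<open>e\<close> would not be loose.
  The witness looks like \<open>G\<close> on the cores, yet contains an edge of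
  \<open>H - G\<close>.\<close>

lemma (in linked_cores) loose_witness:
  assumes "loose G H W r e" "e \<in> H - G"
  obtains D where "D \<in> W" "agrees G r D" "e \<in> D"
proof -
  obtain D where D: "D \<in> W" "agrees G e D \<noteq> agrees G r D" and e: "e \<in> differ G H"
    using assms by (auto simp: loose_def)
  have "\<exists>D\<in>W. agrees G r D \<and> \<not> agrees G e D"
  proof (rule ccontr)
    assume "\<not> ?thesis"
    then have imp: "\<And>D. D \<in> W \<Longrightarrow> agrees G r D \<Longrightarrow> agrees G e D" by blast
    then show False using W_tight[OF D(1) r_differ e imp] D by blast
  qed
  then show thesis using that assms by (auto simp: agrees_def)
qed

lemma (in linked_cores) tight_agrees:
  assumes "D \<in> W" "agrees G r D" "\<not> loose G H W r e"
  shows "e \<in> G \<Longrightarrow> e \<in> D" and "e \<in> H - G \<Longrightarrow> e \<notin> D"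
proof -
  have "agrees G e D" if "e \<in> differ G H" using that assms by (simp add: loose_def)
  then show "e \<in> G \<Longrightarrow> e \<in> D" and "e \<in> H - G \<Longrightarrow> e \<notin> D"
    using W_lower[OF assms(1), of e] by (auto simp: differ_def agrees_def)
qed

lemma (in linked_cores) edge_in_K:
  assumes "D \<in> W" "agrees G r D" "u \<in> K" "v \<in> K" "u \<noteq> v"
  shows "{u, v} \<in> D"
proof (cases "{u, v} \<in> H")
  case True
  then show ?thesis using W_lower assms edge_K by blast
next
  case False
  then have "{u, v} \<in> core G H K" using edge_K[OF assms(3-5)] assms by (simp add: core_def)
  then show ?thesis using tight_agrees(1)[OF assms(1,2)] loose_not_core edge_K[OF assms(3-5)] by blast
qed

lemma (in linked_cores) no_bad_triangle:
  assumes "D \<in> W" "{x, y} \<in> D" "{y, z} \<in> D" "{x, z} \<in> D" "{x, y} \<notin> G" "{x, z} \<notin> H"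
    "x \<noteq> y" "x \<noteq> z"
  shows False
proof -
  have "complete_on D {x, y, z}" using assms by (auto simp: complete_on_def insert_commute)
  then have "complete_on G {x, y, z} \<or> complete_on H {x, y, z}" by (rule W_clique[OF assms(1)])
  then show False using assms complete_onD[of G _ x y] complete_onD[of H _ x z] by auto
qed

text \<open>A witness \<open>D\<close> contains the arc and all of \<open>K\<close>. A triangle on
  \<open>v\<close>, \<open>u\<close> and a third vertex of \<open>K\<close> would have to lie in
  \<open>G\<close> or \<open>H\<close>. This makes common neighbours in \<open>L\<close> adjacent to
  \<open>v\<close> in \<open>H\<close>, and keeps out of \<open>D\<close> any edge of
  \<open>G\<close> from \<open>u\<close> to a vertex outside \<open>L\<close>, which is therefore
  loose.\<close>

lemma (in linked_cores) loose_arc_next: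
  assumes v: "arc G H K L v u" "v \<in> K" "loose G H W r {v, u}"
  shows "nbr G u \<inter> L \<subseteq> nbr H v"
    and "x \<in> nbr G u \<Longrightarrow> x \<notin> L \<Longrightarrow> arc G H K L u x \<and> loose G H W r {u, x}"
proof -
  have ac: "v \<notin> L" "u \<in> L" "u \<notin> K" "{v, u} \<in> H - G" using arc_cases[OF v(1)] v(2) by auto
  obtain D where D: "D \<in> W" "agrees G r D" "{v, u} \<in> D" using loose_witness[OF v(3) ac(4)] by blast
  show "nbr G u \<inter> L \<subseteq> nbr H v"
  proof (rule ccontr)
    assume "\<not> nbr G u \<inter> L \<subseteq> nbr H v"
    then obtain c where "c \<in> nbr G u" "c \<in> L" "c \<notin> nbr H v" by blast
    then have c: "{u, c} \<in> G" "c \<in> L" "{v, c} \<notin> H" by (simp_all add: mem_nbr)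
    have "c \<in> K" using in_K[OF c(1)] ac by blast
    have ne: "v \<noteq> c" "u \<noteq> c" "v \<noteq> u" using c ac \<open>c \<in> K\<close> by auto
    have "{u, c} \<in> D" using W_lower[OF D(1) c(1)] sym.edge_K[of u c] ac c ne by blast
    moreover have "{v, c} \<in> D" by (rule edge_in_K[OF D(1,2)]) (use v \<open>c \<in> K\<close> ne in auto)
    ultimately show False using no_bad_triangle[OF D(1,3)] c ac ne by blast
  qed
  assume x: "x \<in> nbr G u" "x \<notin> L"
  then have ux: "{u, x} \<in> G" by (simp add: mem_nbr)
  have xK: "x \<in> K" using in_K[OF ux] ac by blast
  have ne: "v \<noteq> x" "v \<noteq> u" using ux ac v by (auto simp: insert_commute)
  have vx: "{v, x} \<notin> H" using sym.in_K[of v x] x ac by blast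
  have "{v, x} \<in> D" by (rule edge_in_K[OF D(1,2)]) (use v xK ne in auto)
  then have "{u, x} \<notin> D" using no_bad_triangle[OF D(1,3)] vx ac ne by blast
  then have lo: "loose G H W r {u, x}" using tight_agrees(1)[OF D(1,2) _ ux] by blast
  have uxH: "{u, x} \<in> G - H" using lo ux by (auto simp: loose_def differ_def)
  have "{u, x} \<notin> core G H K" using loose_not_core lo by blast
  then have "complete_on H (nbr G u)" using uxH ac by (auto simp: core_def)
  then have "arc G H K L u x" using uxH ac by (simp add: arc_def star_edge_def)
  then show "arc G H K L u x \<and> loose G H W r {u, x}" using lo by blast
qed

text \<open>By \<open>loose_arc_next\<close> the only further arcs that an exchange forces are loose
  ones. It thus suffices to find a set of loose arcs closed under this forcing on which
  \<open>p\<close> is injective; minimal cardinality gives injectivity.\<close>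

lemma (in linked_cores) loose_arc_exchangeable:
  assumes "arc G H K L v0 u0" "loose G H W r {v0, u0}"
  shows "exchangeable G H"
proof -
  define p where "p v = (THE u. arc G H K L v u)" for v
  have p: "p v = u" if "arc G H K L v u" for v u
    unfolding p_def using that arc_unique by blast
  define A where "A = {v. arc G H K L v (p v) \<and> loose G H W r {v, p v}}"
  have A: "v \<in> A \<and> p v = u" if "arc G H K L v u" "loose G H W r {v, u}" for v u
    using p[OF that(1)] that by (auto simp: A_def)
  define closed where "closed X \<longleftrightarrow> X \<noteq> {} \<and> X \<subseteq> A \<and> (\<forall>v\<in>X. p v \<in> A \<longrightarrow> p v \<in> X)" for X
  have "closed A" using A[OF assms] by (auto simp: closed_def)
  then obtain X where X: "closed X" and least: "\<And>Z. closed Z \<Longrightarrow> card X \<le> card Z"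
    using ex_has_least_nat[of closed A card] by blast
  \<comment> \<open>a minimal closed set is the end of a chain of arcs or a cycle\<close>
  have inj: "inj_on p X"
  proof (cases "\<exists>v\<in>X. p v \<notin> A")
    case True
    then obtain v where v: "v \<in> X" "p v \<notin> A" by blast
    then have "closed {v}" using X by (auto simp: closed_def)
    then have "card X \<le> 1" using least by fastforce
    then show ?thesis using card_le_Suc0_iff_eq[of X] by (auto simp: inj_on_def)
  next
    case False
    then have sub: "p ` X \<subseteq> X" using X by (auto simp: closed_def)
    then have "closed (p ` X)" using X by (auto simp: closed_def)
    then have "card X \<le> card (p ` X)" by (rule least)
    then have "card (p ` X) = card X" using card_image_le[of X p] by simp
    then show ?thesis by (intro eq_card_imp_inj_on) auto
  qed
  have XA: "arc G H K L v (p v)" "loose G H W r {v, p v}" if "v \<in> X" for v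
    using that X by (auto simp: closed_def A_def)
  have next': "p v \<in> X \<and> p (p v) = x" if "v \<in> X" "arc G H K L (p v) x" "loose G H W r {p v, x}" for v x
    using A[OF that(2,3)] that(1) X by (auto simp: closed_def)
  show ?thesis
  proof (rule arc_swap[of X p])
    show "X \<noteq> {}" using X by (simp add: closed_def)
    show "core G H K \<union> core H G L \<noteq> {}" using r by blast
    fix v assume v: "v \<in> X"
    show "arc G H K L v (p v)" by (rule XA[OF v])
    {
      assume "v \<in> K"
      note nx = loose_arc_next[OF XA(1)[OF v] this XA(2)[OF v]]
      show "nbr G (p v) \<inter> L \<subseteq> nbr H v" by (rule nx)
      show "p v \<in> X \<and> p (p v) = x" if "x \<in> nbr G (p v)" "x \<notin> L" for x
        using next'[OF v] nx(2)[OF that] by blast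
    next
      assume "v \<in> L"
      note nx = sym.loose_arc_next[unfolded arc_sym loose_sym, OF XA(1)[OF v] this XA(2)[OF v]]
      show "nbr H (p v) \<inter> K \<subseteq> nbr G v" by (rule nx)
      show "p v \<in> X \<and> p (p v) = x" if "x \<in> nbr H (p v)" "x \<notin> K" for x
        using next'[OF v] nx(2)[OF that] by blast
    }
  qed (rule inj)
qed

lemma (in linked_cores) differ_in_clique:
  obtains e where "e \<in> differ G H" "e \<subseteq> K \<or> e \<subseteq> L"
proof (cases "core G H K = {}")
  case False
  then obtain e where "e \<in> G - H" "e \<subseteq> K" using core_in_clique by blast
  then show thesis using that[of e] by (simp add: differ_def)
next
  case True
  then have "core H G L \<noteq> {}" using r by blast
  then obtain e where "e \<in> H - G" "e \<subseteq> L" using sym.core_in_clique by blast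
  then show thesis using that[of e] by (simp add: differ_def)
qed

text \<open>If the neighbourhood of \<open>i\<close> in \<open>G\<close> is a clique of
  \<open>H\<close>, all differing edges at \<open>i\<close> can move. Otherwise the edges of
  \<open>G - H\<close> at \<open>i\<close> are core edges, and a witness \<open>D\<close> contains
  every edge at \<open>i\<close> from both graphs. Its triangles and four-cycles then yield the
  hypotheses of \<open>pendant_swap\<close>.\<close>

lemma (in linked_cores) loose_star_exchangeable:
  assumes no_arc: "\<And>v u. arc G H K L v u \<Longrightarrow> \<not> loose G H W r {v, u}"
    and st: "star_edge H G L i t" and iK: "i \<notin> K" and lo: "loose G H W r {i, t}"
  shows "exchangeable G H"
proof (cases "complete_on H (nbr G i)")
  case True
  have i: "i \<notin> L" "complete_on G (nbr H i)" "t \<in> nbr H i" "t \<notin> nbr G i"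
    using st by (auto simp: star_edge_def mem_nbr)
  obtain e where "e \<in> differ G H" "e \<subseteq> K \<or> e \<subseteq> L" using differ_in_clique by blast
  then have "e \<in> differ G H" "i \<notin> e" using i iK by auto
  then show ?thesis using vertex_swap[OF iK i(1) True i(2)] i by blast
next
  case False
  have iL: "i \<notin> L" and cl: "complete_on G (nbr H i)" and it: "{i, t} \<in> H - G"
    using st by (auto simp: star_edge_def)
  obtain D where D: "D \<in> W" "agrees G r D" "{i, t} \<in> D" using loose_witness[OF lo it] by blast
  have tD: "e \<in> D" if "e \<in> G" "\<not> loose G H W r e" for e using tight_agrees(1)[OF D(1,2)] that by blast
  have new_D: "{i, x} \<in> D" if "x \<in> nbr H i" "x \<notin> nbr G i" for x
  proof (rule W_closed_H[OF D(1), of "insert i (nbr H i)" "{i, t}"])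
    show "complete_on H (insert i (nbr H i))" by (intro complete_on_closed_nbr sym.nbr_clique iL)
  qed (use it that D in \<open>auto simp: mem_nbr\<close>)
  have core_i: "{i, x} \<in> core G H K" if "x \<in> nbr G i" "x \<notin> nbr H i" for x
    using that iK False by (auto simp: core_def mem_nbr)
  have old_D: "{i, x} \<in> D" if x: "x \<in> nbr G i" for x
  proof (cases "x \<in> nbr H i")
    case True then show ?thesis using W_lower[OF D(1)] x by (simp add: mem_nbr)
  next
    case False
    then show ?thesis using tD[of "{i, x}"] loose_not_core core_i[OF x False] x by (auto simp: mem_nbr)
  qed
  have "\<not> nbr G i \<subseteq> nbr H i"
    using False sym.nbr_clique[OF iL] by (auto simp: complete_on_def)
  \<comment> \<open>The edge from \<open>i\<close> to \<open>k\<close> is missing in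
    \<open>H\<close>, so a triangle of \<open>D\<close> through it must be a triangle of
    \<open>G\<close>. This bars new neighbours of \<open>i\<close> from \<open>K\<close>.\<close>
  then obtain k where k: "k \<in> nbr G i" "k \<notin> nbr H i" by blast
  then have kK: "k \<in> K" using nbr_subset[OF iK] by blast
  have notK: "x \<notin> K" if x: "x \<in> nbr H i" "x \<notin> nbr G i" for x
  proof
    assume "x \<in> K"
    then have "{x, k} \<in> D" using edge_in_K[OF D(1,2)] kK x k by blast
    then show False
      using no_bad_triangle[OF D(1) new_D[OF x] _ old_D[OF k(1)]] x k not_self_nbr sym.not_self_nbr
      by (metis mem_nbr)
  qed
  have tn: "t \<in> nbr H i" "t \<notin> nbr G i" using it by (auto simp: mem_nbr)
  have t: "t \<in> L" "t \<notin> K" using sym.nbr_subset[OF iL] tn notK by auto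
  have only: "nbr H i - nbr G i = {t}"
  proof -
    have "x = t" if x: "x \<in> nbr H i" "x \<notin> nbr G i" for x
      using sym.nbr_outside_L[OF cl x(1) tn(1) notK[OF x] t(2)] .
    then show ?thesis using tn by blast
  qed
  have t_edge: "{t, x} \<in> D" if x: "x \<in> nbr G t" for x
  proof (rule tD)
    show xt: "{t, x} \<in> G" using x by (simp add: mem_nbr)
    show "\<not> loose G H W r {t, x}"
    proof
      assume l: "loose G H W r {t, x}"
      then have "{t, x} \<in> G - H" using xt by (auto simp: loose_def differ_def)
      moreover have "{t, x} \<notin> core G H K" using loose_not_core[OF l] by blast
      ultimately have "arc G H K L t x" using t by (auto simp: arc_def star_edge_def core_def)
      then show False using no_arc l by blast
    qed
  qed
  have ne: "i \<noteq> t" using it sym.loop_G by auto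
  have common: "nbr G i \<inter> nbr G t \<subseteq> nbr H i"
  proof (rule ccontr)
    assume "\<not> nbr G i \<inter> nbr G t \<subseteq> nbr H i"
    then obtain x where x: "x \<in> nbr G i" "x \<in> nbr G t" "x \<notin> nbr H i" by blast
    have "i \<noteq> x" using x(1) not_self_nbr by auto
    then show False
      using no_bad_triangle[OF D(1,3) t_edge[OF x(2)] old_D[OF x(1)]] it x ne by (simp add: mem_nbr)
  qed
  have nested: "nbr G t \<subseteq> nbr G i \<or> nbr G i \<subseteq> nbr G t"
  proof (rule ccontr)
    assume "\<not> ?thesis"
    then obtain x y where x: "x \<in> nbr G t" "x \<notin> nbr G i" and y: "y \<in> nbr G i"
        "y \<notin> nbr G t" by blast
    have K: "x \<in> K" "y \<in> K" using x y nbr_subset iK t by blast+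
    have xy: "x \<noteq> y" using x y by blast
    have "{x, y} \<in> D" by (rule edge_in_K[OF D(1,2) K xy])
    moreover have "distinct [i, t, x, y]" using K iK t ne xy by auto
    \<comment> \<open>The four-cycle \<open>i\<close>, \<open>t\<close>, \<open>x\<close>,
      \<open>y\<close> of the chordal graph \<open>D\<close> needs a chord. One diagonal would be a
      second new neighbour of \<open>i\<close>, the other a loose arc from \<open>y\<close> to
      \<open>t\<close>.\<close>
    ultimately have "{i, x} \<in> D \<or> {t, y} \<in> D"
      using chordal_four_cycle[OF W_chordal[OF D(1)], of i t x y] D(3) t_edge[OF x(1)] old_D[OF y(1)]
      by (simp add: insert_commute)
    then show False
    proof
      assume "{i, x} \<in> D"
      then have "x \<in> nbr H i" using W_upper[OF D(1)] x by (auto simp: mem_nbr)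
      then have "x = t" using only x by blast
      then show False using K t by simp
    next
      assume tyD: "{t, y} \<in> D"
      then have ty: "{t, y} \<in> H - G" using W_upper[OF D(1)] y by (auto simp: mem_nbr)
      then have l: "loose G H W r {t, y}" using tight_agrees(2)[OF D(1,2)] tyD by blast
      have nc: "{t, y} \<notin> core H G L" using loose_not_core[OF l] by blast
      have "y \<notin> L" using nc ty t by (auto simp: core_def)
      then have "arc G H K L y t"
        using nc ty K(2) by (auto simp: arc_def star_edge_def core_def insert_commute)
      then show False using no_arc[of y t] l by (simp add: insert_commute)
    qed
  qed
  obtain e where "e \<in> differ G H" "e \<subseteq> K \<or> e \<subseteq> L" using differ_in_clique by blast
  then have "e \<in> differ G H" "e \<noteq> {i, t}" using iL iK by auto
  then show ?thesis using pendant_swap[OF iK iL t only cl common nested] by blast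
qed

lemma (in linked_cores) loose_exchangeable:
  assumes "loose G H W r e"
  shows "exchangeable G H"
proof (cases "\<exists>v u. arc G H K L v u \<and> loose G H W r {v, u}")
  case True then show ?thesis using loose_arc_exchangeable by blast
next
  case False
  then have no: "\<And>v u. arc G H K L v u \<Longrightarrow> \<not> loose G H W r {v, u}" by blast
  have nc: "e \<notin> core G H K" "e \<notin> core H G L" using loose_not_core[OF assms] by auto
  have "e \<in> G - H \<or> e \<in> H - G" using assms by (auto simp: loose_def differ_def)
  then show ?thesis
  proof
    assume "e \<in> H - G"
    then obtain i t where it: "e = {i, t}" "star_edge H G L i t" using sym.core_or_star nc by blast
    have "i \<notin> K"
      using no[of i t] it assms by (auto simp: arc_def star_edge_def)
    then show ?thesis using loose_star_exchangeable[OF no it(2)] it assms by blast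
  next
    assume "e \<in> G - H"
    then obtain i t where it: "e = {i, t}" "star_edge G H K i t" using core_or_star nc by blast
    have "i \<notin> L"
      using no[of i t] it assms by (auto simp: arc_def star_edge_def)
    then have "exchangeable H G"
      using sym.loose_star_exchangeable[unfolded arc_sym loose_sym, OF no it(2)] it assms by blast
    then show ?thesis by (simp add: exchangeable_commute)
  qed
qed

lemma (in linked_cores) linked_exchangeable:
  assumes "D \<in> W" "D \<noteq> G" "D \<noteq> H"
  shows "exchangeable G H"
proof -
  obtain e where "e \<in> differ G H" "agrees G e D \<noteq> agrees G r D"
  proof (cases "agrees G r D")
    case True
    obtain e where "(e \<in> D) \<noteq> (e \<in> G)" using assms(2) by blast
    then have "e \<in> differ G H" "\<not> agrees G e D"
      using W_lower[OF assms(1), of e] W_upper[OF assms(1), of e] by (auto simp: differ_def agrees_def)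
    then show thesis using that True by blast
  next
    case False
    obtain e where "(e \<in> D) \<noteq> (e \<in> H)" using assms(3) by blast
    then have "e \<in> differ G H" "agrees G e D"
      using W_lower[OF assms(1), of e] W_upper[OF assms(1), of e] by (auto simp: differ_def agrees_def)
    then show thesis using that False by blast
  qed
  then have "loose G H W r e" using assms(1) by (auto simp: loose_def)
  then show ?thesis by (rule loose_exchangeable)
qed


section \<open>Unlinked cores\<close>

text \<open>\<open>twin\<close> and \<open>acyclic\<close> express that neither
  \<open>vertex_swap\<close> nor \<open>arc_cycle_swap\<close> is available, so they may be assumed
  when arguing by contradiction.\<close>

locale unlinked_cores = split_pair +
  fixes D1 D0
  assumes D1: "D1 \<in> W" "core G H K \<union> core H G L \<subseteq> D1"
    and D0: "D0 \<in> W" "(core G H K \<union> core H G L) \<inter> D0 = {}"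
    and cores_ne: "core G H K \<noteq> {}" "core H G L \<noteq> {}"
    and twin: "i \<notin> K \<Longrightarrow> i \<notin> L \<Longrightarrow>
        complete_on H (nbr G i) \<Longrightarrow> complete_on G (nbr H i) \<Longrightarrow> nbr G i = nbr H i"
    and acyclic: "Y \<noteq> {} \<Longrightarrow> (\<And>v. v \<in> Y \<Longrightarrow>
        \<exists>u. arc G H K L v u) \<Longrightarrow> \<exists>v\<in>Y. \<forall>u\<in>Y. \<not> arc G H K L u v"

text \<open>Removing these edges fixes one convention for them: they all go to the partner without
  the cores, whatever \<open>D1\<close> did with them.\<close>

definition outer_stars :: "'n edges \<Rightarrow> 'n edges \<Rightarrow> 'n set \<Rightarrow> 'n set \<Rightarrow> 'n edges" where
  "outer_stars G H K L = {{i, u} | i u. i \<notin> K \<and> i \<notin> L \<and> (star_edge G H K i u \<or> star_edge H G L i u)}"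

lemma outer_stars_commute: "outer_stars H G L K = outer_stars G H K L"
  by (auto simp: outer_stars_def)

sublocale unlinked_cores \<subseteq> sym: unlinked_cores H G L K W D1 D0
proof unfold_locales
  show "D1 \<in> W" "core H G L \<union> core G H K \<subseteq> D1" "D0 \<in> W"
      "(core H G L \<union> core G H K) \<inter> D0 = {}"
    "core H G L \<noteq> {}" "core G H K \<noteq> {}"
    using D1 D0 cores_ne by blast+
  show "nbr H i = nbr G i"
    if "i \<notin> L" "i \<notin> K" "complete_on G (nbr H i)" "complete_on H (nbr G i)" for i
    using twin[of i] that by simp
  show "\<exists>v\<in>Y. \<forall>u\<in>Y. \<not> arc H G L K u v"
    if "Y \<noteq> {}" "\<And>v. v \<in> Y \<Longrightarrow> \<exists>u. arc H G L K v u" for Y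
    using acyclic[OF that(1)] that(2) unfolding arc_sym by blast
qed

lemma (in split_pair) outer_stars_sym: "outer_stars H G L K = outer_stars G H K L"
  by (rule outer_stars_commute)

lemma (in unlinked_cores) outer_star_iff:
  assumes "i \<notin> K" "i \<notin> L" "{i, u} \<in> G - H"
  shows "{i, u} \<in> outer_stars G H K L \<longleftrightarrow> complete_on H (nbr G i)"
proof -
  have u: "u \<in> K" using in_K[of i u] assms by blast
  show ?thesis
  proof
    assume "{i, u} \<in> outer_stars G H K L"
    then obtain j w where jw: "{i, u} = {j, w}" "j \<notin> K" "star_edge G H K j w \<or> star_edge H G L j w"
      unfolding outer_stars_def by blast
    then have "j = i" using u by (auto simp: doubleton_eq_iff)
    moreover have "star_edge G H K j w" using jw assms(3) by (auto simp: star_edge_def)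
    ultimately show "complete_on H (nbr G i)" by (simp add: star_edge_def)
  next
    assume "complete_on H (nbr G i)"
    then have "star_edge G H K i u" using assms by (simp add: star_edge_def)
    then show "{i, u} \<in> outer_stars G H K L" using assms unfolding outer_stars_def by blast
  qed
qed

lemma (in unlinked_cores) outer_star_obtains:
  assumes "e \<in> outer_stars G H K L" "e \<in> G"
  obtains i u where "e = {i, u}" "i \<notin> K" "i \<notin> L" "e \<in> G - H" "complete_on H (nbr G i)"
  using assms by (auto simp: outer_stars_def star_edge_def)

lemma (in unlinked_cores) outer_star_differ: "outer_stars G H K L \<subseteq> differ G H"
  by (auto simp: outer_stars_def star_edge_def differ_def)

lemma (in unlinked_cores) core_not_outer:
  assumes "e \<in> core G H K" shows "e \<notin> outer_stars G H K L"
proof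
  assume "e \<in> outer_stars G H K L"
  then obtain i u where "e = {i, u}" "star_edge G H K i u \<or> star_edge H G L i u"
    by (auto simp: outer_stars_def)
  then show False using assms star_edge_not_core by (auto simp: star_edge_def core_def)
qed

text \<open>
  Of the two partners, the first is the member D1 containing both cores, with the star edges at
  vertices outside both cliques removed. The second has neither core.
\<close>

definition (in unlinked_cores) with_cores where
  "with_cores = D1 - outer_stars G H K L"

definition (in unlinked_cores) without_cores where
  "without_cores = (G \<inter> H) \<union> (differ G H - with_cores)"

lemma (in unlinked_cores) with_cores_sym: "sym.with_cores = with_cores"
  by (simp add: with_cores_def sym.with_cores_def outer_stars_sym)

lemma (in unlinked_cores) without_cores_sym: "sym.without_cores = without_cores"
  by (auto simp: without_cores_def sym.without_cores_def with_cores_sym differ_commute[of H G])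

section \<open>The partner containing both cores\<close>

lemma (in unlinked_cores) core_with: "core G H K \<subseteq> with_cores"
  using D1 core_not_outer by (auto simp: with_cores_def)

lemma (in unlinked_cores) common_with: "e \<in> G \<Longrightarrow> e \<in> H \<Longrightarrow> e \<in> with_cores"
  using W_lower[OF D1(1)] outer_star_differ by (auto simp: with_cores_def differ_def)

lemma (in unlinked_cores) with_upper: "e \<in> with_cores \<Longrightarrow> e \<in> G \<or> e \<in> H"
  using W_upper[OF D1(1)] by (auto simp: with_cores_def)

lemma (in unlinked_cores) with_K:
  assumes "u \<in> K" "v \<in> K" "u \<noteq> v" shows "{u, v} \<in> with_cores"
  using edge_K[OF assms] edge_in_K_core[of u v] core_with common_with assms by blast

lemma (in unlinked_cores) with_nbr:
  assumes "i \<notin> K" "i \<notin> L" "complete_on G (nbr H i)" "{i, x} \<in> with_cores"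
  shows "x \<in> nbr G i"
proof (rule ccontr)
  assume "x \<notin> nbr G i"
  then have "{i, x} \<in> H - G" using with_upper[OF assms(4)] by (auto simp: mem_nbr)
  then have "{i, x} \<in> outer_stars G H K L"
    using sym.outer_star_iff[of i x] assms by (simp add: outer_stars_sym)
  then show False using assms(4) by (simp add: with_cores_def)
qed

lemma (in unlinked_cores) with_simplicial:
  assumes "i \<notin> K" "i \<notin> L" "complete_on G (nbr H i)" "{i, x} \<in> with_cores"
      "{i, y} \<in> with_cores" "x \<noteq> y"
  shows "{x, y} \<in> with_cores"
  using with_nbr[OF assms(1-3)] assms(4-6) nbr_subset[OF assms(1)] by (intro with_K) blast+

text \<open>On \<open>?X\<close> no edge was removed, so the graph agrees there with the chordal
  \<open>D1\<close>. The remaining vertices are centres at which the stars of one graph are gone;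
  their neighbours lie in one of the cliques \<open>K\<close>, \<open>L\<close>, which makes them
  simplicial.\<close>

lemma (in unlinked_cores) chordal_with: "chordal with_cores"
proof (rule chordal_elimination)
  let ?X = "{v. v \<in> K \<or> v \<in> L \<or> \<not> complete_on H (nbr G v) \<and> \<not> complete_on G (nbr H v)}"
  show "simple_graph with_cores"
    using W_chordal[OF D1(1)] by (auto simp: chordal_def simple_graph_def with_cores_def)
  have "restrict_graph with_cores ?X = restrict_graph D1 ?X"
    by (auto simp: restrict_graph_def with_cores_def outer_stars_def star_edge_def)
  then show "chordal (restrict_graph with_cores ?X)"
    using chordal_restrict[OF W_chordal[OF D1(1)]] by simp
  fix Y assume Y: "Y \<noteq> {}" "Y \<inter> ?X = {}"
  then obtain v where v: "v \<in> Y" "v \<notin> K" "v \<notin> L"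
      "complete_on H (nbr G v) \<or> complete_on G (nbr H v)"
    by blast
  have "{x, y} \<in> with_cores" if "{v, x} \<in> with_cores" "{v, y} \<in> with_cores" "x \<noteq> y" for x y
    using v(4) with_simplicial[OF v(2,3) _ that] sym.with_simplicial[OF v(3,2), unfolded with_cores_sym, OF _ that]
    by blast
  then show "\<exists>v\<in>Y. \<forall>x\<in>?X \<union> Y. \<forall>y\<in>?X \<union> Y. x \<noteq> y \<longrightarrow> {v, x} \<in> with_cores \<longrightarrow> {v, y} \<in> with_cores \<longrightarrow> {x, y} \<in> with_cores"
    by (intro bexI[OF _ v(1)]) simp
qed

section \<open>The partner containing neither core\<close>

lemma (in unlinked_cores) without_G:
  assumes "e \<in> without_cores" "e \<notin> H"
  shows "e \<in> G - H" "e \<notin> core G H K"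
  using assms core_with by (auto simp: without_cores_def differ_def)

lemma (in unlinked_cores) common_without: "e \<in> G \<Longrightarrow> e \<in> H \<Longrightarrow>
    e \<in> without_cores"
  by (simp add: without_cores_def)

lemma (in unlinked_cores) without_star:
  assumes "{v, u} \<in> without_cores" "{v, u} \<notin> H" "v \<notin> K"
  shows "star_edge G H K v u"
  using without_G[OF assms(1,2)] assms(3) by (auto simp: star_edge_def core_def)

lemma (in unlinked_cores) without_K:
  assumes "u \<in> K" "v \<in> K" "{u, v} \<in> without_cores"
  shows "{u, v} \<in> H"
  using without_G[OF assms(3)] assms edge_in_K_core by blast

text \<open>Outside the cores only stars are left. Stars of both kinds at \<open>i\<close> would
  make both neighbourhoods cliques of the opposite graph; by \<open>twin\<close> they would be equal
  and leave no star at all.\<close>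

lemma (in unlinked_cores) without_outer_nbr:
  assumes i: "i \<notin> K" "i \<notin> L" and x: "{i, x} \<in> without_cores" "{i, x} \<notin> H"
  shows "complete_on H (nbr G i)" "{i, y} \<in> without_cores \<Longrightarrow> {i, y} \<in> G"
proof -
  have st: "star_edge G H K i x" by (rule without_star[OF x i(1)])
  then show cl: "complete_on H (nbr G i)" by (simp add: star_edge_def)
  assume y: "{i, y} \<in> without_cores"
  show "{i, y} \<in> G"
  proof (rule ccontr)
    assume "{i, y} \<notin> G"
    then have "star_edge H G L i y"
      using sym.without_star[unfolded without_cores_sym, OF y _ i(2)] by blast
    then have "nbr G i = nbr H i" using twin[OF i cl] by (simp add: star_edge_def)
    then show False using st by (auto simp: star_edge_def mem_nbr set_eq_iff)
  qed
qed

lemma (in unlinked_cores) without_outer_simplicial: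
  assumes i: "i \<notin> K" "i \<notin> L" and xy: "{i, x} \<in> without_cores" "{i, y} \<in> without_cores"
      "x \<noteq> y"
  shows "{x, y} \<in> without_cores"
proof -
  have up: "e \<in> G \<or> e \<in> H" if "e \<in> without_cores" for e using that
      by (auto simp: without_cores_def differ_def)
  have "{x, y} \<in> G \<and> {x, y} \<in> H"
  proof (cases "\<exists>z. {i, z} \<in> without_cores \<and> {i, z} \<notin> H")
    case True
    then have "complete_on H (nbr G i)" "x \<in> nbr G i" "y \<in> nbr G i"
      using without_outer_nbr[OF i] xy by (auto simp: mem_nbr)
    then show ?thesis using complete_onD nbr_clique[OF i(1)] xy(3) by metis
  next
    case allH: False
    show ?thesis
    proof (cases "\<exists>z. {i, z} \<in> without_cores \<and> {i, z} \<notin> G")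
      case True
      then have "complete_on G (nbr H i)" "x \<in> nbr H i" "y \<in> nbr H i"
        using sym.without_outer_nbr[unfolded without_cores_sym, OF i(2,1)] xy by (auto simp: mem_nbr)
      then show ?thesis using complete_onD sym.nbr_clique[OF i(2)] xy(3) by metis
    next
      case False
      then have "x \<in> nbr G i" "y \<in> nbr G i" "x \<in> nbr H i" "y \<in> nbr H i"
        using allH xy by (auto simp: mem_nbr)
      then show ?thesis using nbr_clique[OF i(1)] sym.nbr_clique[OF i(2)] complete_onD xy(3) by metis
    qed
  qed
  then show ?thesis using common_without by blast
qed

text \<open>A neighbour outside \<open>nbr H v\<close> would come from an edge of
  \<open>G - H\<close> that is not core. Its centre is then \<open>x\<close>, which gives an arc
  from \<open>x\<close> to \<open>v\<close>.\<close>

lemma (in unlinked_cores) without_leaf_nbr: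
  assumes v: "v \<in> K" "v \<notin> L" and x: "x \<in> K \<or> x \<in> L" "{v, x} \<in> without_cores"
    and leaf: "\<not> arc G H K L x v"
  shows "x \<in> nbr H v"
proof (rule ccontr)
  assume "x \<notin> nbr H v"
  then have n: "{v, x} \<notin> H" by (simp add: mem_nbr)
  then have xK: "x \<notin> K" using without_K[OF v(1)] x(2) by blast
  then have "star_edge G H K x v"
    using without_star[of x v] x n by (simp add: insert_commute)
  then show False using leaf xK x(1) by (simp add: arc_def)
qed

lemma (in unlinked_cores) without_leaf_simplicial:
  assumes v: "v \<in> K" "v \<notin> L" "arc G H K L v u"
    and x: "x \<in> K \<or> x \<in> L" "{v, x} \<in> without_cores" "\<not> arc G H K L x v"
    and y: "y \<in> K \<or> y \<in> L" "{v, y} \<in> without_cores" "\<not> arc G H K L y v"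
    and xy: "x \<noteq> y"
  shows "{x, y} \<in> without_cores"
proof -
  have "complete_on G (nbr H v)" using arc_cases[OF v(3)] v by blast
  moreover have "complete_on H (nbr H v)" by (rule sym.nbr_clique[OF v(2)])
  moreover have "x \<in> nbr H v" "y \<in> nbr H v" using without_leaf_nbr[OF v(1,2)] x y by blast+
  ultimately show ?thesis using xy complete_onD common_without by metis
qed

lemma (in unlinked_cores) without_restrict_D0:
  assumes e: "e \<in> G - H" "e \<subseteq> K \<union> L" and noarc: "\<And>v u. v \<in> e \<Longrightarrow>
      \<not> arc G H K L v u"
  shows "e \<in> core G H K"
proof (rule ccontr)
  assume "e \<notin> core G H K"
  then obtain v u where vu: "e = {v, u}" "star_edge G H K v u" using core_or_star e by blast
  then have "v \<in> L - K" using e by (auto simp: star_edge_def)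
  then have "arc G H K L v u" using vu by (simp add: arc_def)
  then show False using noarc vu by blast
qed

text \<open>Vertices outside both cliques are eliminated first. Next come vertices with an outgoing
  arc, always one that no remaining vertex points to, which exists by \<open>acyclic\<close>. On
  what is left, every differing edge is a core edge, so the graph agrees with
  \<open>D0\<close>.\<close>

lemma (in unlinked_cores) chordal_without: "chordal without_cores"
proof (rule chordal_elimination)
  let ?X = "{v. (v \<in> K \<or> v \<in> L) \<and> (\<forall>u. \<not> arc G H K L v u)}"
  show "simple_graph without_cores"
    using simple_G simple_H by (auto simp: simple_graph_def without_cores_def differ_def)
  have "e \<in> without_cores \<longleftrightarrow> e \<in> D0" if eX: "e \<subseteq> ?X" for e
  proof (cases "e \<in> differ G H")
    case True
    have no: "\<And>v u. v \<in> e \<Longrightarrow> \<not> arc G H K L v u"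
        and KL: "e \<subseteq> K \<union> L" "e \<subseteq> L \<union> K" using eX by auto
    have "e \<in> core G H K \<union> core H G L"
      using True without_restrict_D0[OF _ KL(1) no] sym.without_restrict_D0[unfolded arc_sym, OF _ KL(2) no]
      by (auto simp: differ_def)
    moreover from this have "e \<in> with_cores"
      using core_with sym.core_with[unfolded with_cores_sym] by blast
    ultimately show ?thesis using D0(2) True by (auto simp: without_cores_def differ_def)
  next
    case False
    then show ?thesis using W_lower[OF D0(1), of e] W_upper[OF D0(1), of e]
      by (auto simp: without_cores_def differ_def)
  qed
  then have "restrict_graph without_cores ?X = restrict_graph D0 ?X"
    by (auto simp: restrict_graph_def)
  then show "chordal (restrict_graph without_cores ?X)"
    using chordal_restrict[OF W_chordal[OF D0(1)]] by simp
  fix Y assume Y: "Y \<noteq> {}" "Y \<inter> ?X = {}"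
  show "\<exists>v\<in>Y. \<forall>x\<in>?X \<union> Y. \<forall>y\<in>?X \<union> Y. x \<noteq> y \<longrightarrow> {v, x} \<in> without_cores \<longrightarrow> {v, y} \<in> without_cores \<longrightarrow> {x, y} \<in> without_cores"
  proof (cases "\<exists>i\<in>Y. i \<notin> K \<and> i \<notin> L")
    case True
    then show ?thesis using without_outer_simplicial by blast
  next
    case False
    then have arcs: "\<exists>u. arc G H K L v u" if "v \<in> Y" for v using that Y by blast
    then obtain v where v: "v \<in> Y" "\<And>u. u \<in> Y \<Longrightarrow> \<not> arc G H K L u v"
        using acyclic[OF Y(1)] by blast
    obtain u where u: "arc G H K L v u" using arcs v by blast
    have XY: "(x \<in> K \<or> x \<in> L) \<and> \<not> arc G H K L x v" if "x \<in> ?X \<union> Y" for x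
      using that v(2) False by blast
    have "{x, y} \<in> without_cores"
      if x: "x \<in> ?X \<union> Y" "{v, x} \<in> without_cores" and y: "y \<in> ?X \<union> Y"
          "{v, y} \<in> without_cores" and xy: "x \<noteq> y" for x y
    proof -
      have "v \<in> K \<and> v \<notin> L \<or> v \<in> L \<and> v \<notin> K" using arc_cases[OF u] by blast
      then show ?thesis
      proof
        assume "v \<in> K \<and> v \<notin> L"
        then show ?thesis using without_leaf_simplicial[of v u x y] u XY[OF x(1)] XY[OF y(1)] x y xy by blast
      next
        assume "v \<in> L \<and> v \<notin> K"
        then show ?thesis
          using sym.without_leaf_simplicial[unfolded arc_sym without_cores_sym, of v u x y]
            u XY[OF x(1)] XY[OF y(1)] x y xy by blast
      qed
    qed
    then show ?thesis by (intro bexI[OF _ v(1)]) simp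
  qed
qed

lemma (in unlinked_cores) without_inner:
  assumes S: "complete_on without_cores S" and xy: "x \<in> S" "y \<in> S" "{x, y} \<in> G" "{x, y} \<notin> H"
    and zw: "z \<in> S" "w \<in> S" "z \<in> K - L" "w \<in> L - K"
  shows "\<exists>i\<in>S. i \<notin> K \<and> i \<notin> L \<or> {x, y} = {z, w}"
proof (rule ccontr)
  assume n: "\<not> ?thesis"
  then have KL: "s \<in> K \<or> s \<in> L" if "s \<in> S" for s using that by blast
  have oneK: "s = z" if "s \<in> S" "s \<in> K - L" for s
  proof (rule ccontr)
    assume "s \<noteq> z"
    then have "{s, z} \<in> without_cores" using complete_onD[OF S] that zw by blast
    then have "{s, z} \<in> H" using without_K that zw by blast
    then show False using sym.in_K[of s z] that zw by blast
  qed
  have oneL: "s = w" if "s \<in> S" "s \<in> L - K" for s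
  proof (rule ccontr)
    assume "s \<noteq> w"
    then have "{s, w} \<in> without_cores" using complete_onD[OF S] that zw by blast
    then have "{s, w} \<in> G" using sym.without_K[unfolded without_cores_sym] that zw by blast
    then show False using in_K[of s w] that zw by blast
  qed
  have ne: "x \<noteq> y" using edge_ne xy by blast
  have "{x, y} \<in> without_cores" using complete_onD[OF S xy(1,2) ne] .
  then have "\<not> (x \<in> K \<and> y \<in> K)" "\<not> (x \<in> L \<and> y \<in> L)"
    using without_K xy sym.edge_K ne by blast+
  then have "x \<in> K - L \<and> y \<in> L - K \<or> x \<in> L - K \<and> y \<in> K - L" using KL xy by blast
  then have "{x, y} = {z, w}" using oneK oneL xy by (auto simp: insert_commute)
  then show False using n xy by blast
qed

text \<open>Either \<open>y\<close> is outside \<open>L\<close>, and \<open>i\<close> and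
  \<open>y\<close> are not adjacent in \<open>H\<close>; or \<open>x\<close> is outside both cliques
  and must be \<open>i\<close>, as neither graph joins two such vertices.\<close>

lemma (in unlinked_cores) without_outer_G:
  assumes S: "complete_on without_cores S" and i: "i \<in> S" "i \<notin> K" "i \<notin> L"
    and xy: "x \<in> S" "y \<in> S" "{x, y} \<in> G" "{x, y} \<notin> H" and y: "y \<in> K"
  shows "\<exists>s\<in>S. {i, s} \<in> without_cores \<and> {i, s} \<notin> H"
proof (cases "y \<in> L")
  case False
  have "i \<noteq> y" using i y by blast
  then have "{i, y} \<in> without_cores" using complete_onD[OF S] i xy by blast
  moreover have "{i, y} \<notin> H" using sym.in_K[of i y] False i by blast
  ultimately show ?thesis using xy by blast
next
  case True
  have ne: "x \<noteq> y" using edge_ne xy by blast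
  have e: "{x, y} \<in> without_cores" using complete_onD[OF S xy(1,2) ne] .
  have "x \<notin> K" using without_K e y xy by blast
  moreover have "x \<notin> L" using sym.edge_K True ne xy by blast
  moreover have "x = i"
  proof (rule ccontr)
    assume "x \<noteq> i"
    then have "{x, i} \<in> without_cores" using complete_onD[OF S] xy i by blast
    then have "{x, i} \<in> G \<or> {x, i} \<in> H" by (auto simp: without_cores_def differ_def)
    then show False using in_K[of x i] sym.in_K[of x i] calculation i by blast
  qed
  ultimately show ?thesis using e xy by blast
qed

text \<open>A bad clique contains an edge of \<open>G - H\<close> and an edge of
  \<open>H - G\<close>. A vertex outside both cliques would have edges of both kinds, against
  \<open>without_outer_nbr\<close>. Hence both edges join \<open>K - L\<close> to
  \<open>L - K\<close>; as the clique has only one vertex in each of these sets, the two edges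
  coincide.\<close>

lemma (in unlinked_cores) without_clique:
  assumes S: "complete_on without_cores S"
  shows "complete_on G S \<or> complete_on H S"
proof (rule ccontr)
  assume "\<not> ?thesis"
  then obtain x y z w where xy: "x \<in> S" "y \<in> S" "x \<noteq> y" "{x, y} \<notin> H"
    and zw: "z \<in> S" "w \<in> S" "z \<noteq> w" "{z, w} \<notin> G" by (auto simp: complete_on_def)
  have xyG: "{x, y} \<in> G" and zwH: "{z, w} \<in> H"
    using complete_onD[OF S] xy zw by (auto simp: without_cores_def differ_def)
  have S': "complete_on sym.without_cores S" using S by (simp add: without_cores_sym)
  have no_outer: "s \<in> K \<or> s \<in> L" if s: "s \<in> S" for s
  proof (rule ccontr)
    assume "\<not> ?thesis"
    then have sKL: "s \<notin> K" "s \<notin> L" by auto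
    have "\<exists>t\<in>S. {s, t} \<in> without_cores \<and> {s, t} \<notin> H"
      using without_outer_G[OF S s sKL, of x y] without_outer_G[OF S s sKL, of y x] xy xyG in_K[of x y]
      by (auto simp: insert_commute)
    moreover have "\<exists>t\<in>S. {s, t} \<in> without_cores \<and> {s, t} \<notin> G"
      using sym.without_outer_G[OF S' s sKL(2,1), of z w] sym.without_outer_G[OF S' s sKL(2,1), of w z]
        zw zwH sym.in_K[of z w] by (auto simp: insert_commute without_cores_sym)
    ultimately show False using without_outer_nbr(2)[OF sKL] by blast
  qed
  have zwD: "{z, w} \<in> without_cores" using complete_onD[OF S] zw by blast
  then have "\<not> (z \<in> K \<and> w \<in> K)" "\<not> (z \<in> L \<and> w \<in> L)"
    using sym.without_K[unfolded without_cores_sym] zw edge_K by blast+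
  then have "z \<in> K - L \<and> w \<in> L - K \<or> w \<in> K - L \<and> z \<in> L - K"
    using no_outer zw by blast
  then have "{x, y} = {z, w}"
    using without_inner[OF S xy(1,2) xyG xy(4), of z w] without_inner[OF S xy(1,2) xyG xy(4), of w z]
      zw no_outer by (auto simp: insert_commute)
  then show False using zwH xy by simp
qed

text \<open>\<open>D1\<close> respects the tie, so only the removal could break it. If the star edge
  \<open>e\<close> at \<open>i\<close> was removed, every edge of \<open>G - H\<close> in the same
  clique of \<open>G\<close> also meets \<open>i\<close> and was removed too.\<close>

lemma (in unlinked_cores) with_closed:
  assumes S: "complete_on G S" and e: "e \<in> G - H" "e \<subseteq> S" and f: "f \<in> G - H" "f \<subseteq> S"
    and fw: "f \<in> with_cores"
  shows "e \<in> with_cores"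
proof (rule ccontr)
  assume ne: "e \<notin> with_cores"
  have "e \<in> D1" using W_closed_G[OF D1(1) S f e] fw by (simp add: with_cores_def)
  then have eo: "e \<in> outer_stars G H K L" using ne by (simp add: with_cores_def)
  obtain i u where i: "e = {i, u}" "i \<notin> K" "i \<notin> L" "complete_on H (nbr G i)"
    using outer_star_obtains[OF eo] e by blast
  obtain x y where xy: "f = {x, y}" "x \<noteq> y" using edge_pair f by blast
  have iS: "i \<in> S" using i e by blast
  have "i \<in> f"
  proof (rule ccontr)
    assume "i \<notin> f"
    then have "x \<in> nbr G i" "y \<in> nbr G i"
      using complete_onD[OF S iS, of x] complete_onD[OF S iS, of y] xy f by (auto simp: mem_nbr)
    then show False using complete_onD[OF i(4)] xy f by auto
  qed
  then obtain z where "f = {i, z}" using xy by (auto simp: insert_commute)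
  then have "f \<in> outer_stars G H K L" using outer_star_iff[OF i(2,3)] f i(4) by blast
  then show False using fw by (simp add: with_cores_def)
qed

lemma (in unlinked_cores) unlinked_exchangeable: "exchangeable G H"
proof -
  define P where "P = {e. (e \<in> G) \<noteq> (e \<in> with_cores)}"
  have sG: "swap G P = with_cores" by (auto simp: P_def swap_def)
  have sH: "swap H P = without_cores"
    using common_with with_upper by (auto simp: P_def swap_def without_cores_def differ_def)
  have "P \<subseteq> differ G H"
    using common_with with_upper by (auto simp: P_def differ_def)
  moreover have "P \<noteq> {}"
  proof -
    obtain e where "e \<in> core H G L" using cores_ne by blast
    then have "e \<in> P" using sym.core_with[unfolded with_cores_sym] by (auto simp: P_def core_def)
    then show ?thesis by blast
  qed
  moreover have "P \<noteq> differ G H"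
  proof -
    obtain e where "e \<in> core G H K" using cores_ne by blast
    then have "e \<notin> P" "e \<in> differ G H" using core_with by (auto simp: P_def core_def differ_def)
    then show ?thesis by blast
  qed
  moreover have "half_exchange G H P"
    unfolding half_exchange_def sG
  proof (intro conjI allI impI chordal_with)
    fix S e f assume *: "complete_on G S" "e \<in> G - H" "f \<in> G - H" "e \<subseteq> S" "f \<subseteq> S"
        "e \<in> P"
    then have "e \<notin> with_cores" by (auto simp: P_def)
    then have "f \<notin> with_cores" using with_closed[OF *(1,2,4,3,5)] by blast
    then show "f \<in> P" using * by (simp add: P_def)
  next
    fix S assume "complete_on with_cores S"
    then have "complete_on D1 S" by (auto simp: complete_on_def with_cores_def)
    then show "complete_on G S \<or> complete_on H S" by (rule W_clique[OF D1(1)])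
  qed
  moreover have "half_exchange H G P"
    unfolding half_exchange_def sH
  proof (intro conjI allI impI chordal_without)
    fix S e f assume *: "complete_on H S" "e \<in> H - G" "f \<in> H - G" "e \<subseteq> S" "f \<subseteq> S"
        "e \<in> P"
    then have "e \<in> with_cores" by (auto simp: P_def)
    then have "f \<in> with_cores" using sym.with_closed[unfolded with_cores_sym, OF *(1,3,5,2,4)] by blast
    then show "f \<in> P" using * by (simp add: P_def)
  next
    fix S assume "complete_on without_cores S"
    then show "complete_on H S \<or> complete_on G S" using without_clique by blast
  qed
  ultimately show ?thesis unfolding exchangeable_def by blast
qed

section \<open>Empty cores\<close>

lemma (in split_pair) edge_at:
  assumes "e \<in> G" "v \<in> e" obtains u where "e = {v, u}"
proof -
  obtain x y where "e = {x, y}" using edge_pair[OF assms(1)] .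
  then show thesis using assms(2) that[of x] that[of y] by (auto simp: insert_commute)
qed

lemma (in split_pair) inner_difference:
  assumes nbrs: "\<And>i. i \<notin> K \<Longrightarrow> i \<notin> L \<Longrightarrow> nbr G i = nbr H i"
    and KH: "complete_on H K" and g: "g \<in> G - H"
  obtains a b where "g = {a, b}" "a \<in> K - L" "b \<in> L - K"
proof -
  obtain u v where uv: "g = {u, v}" "u \<noteq> v" using edge_pair g by blast
  have out: "w \<in> K \<or> w \<in> L" if w: "w \<in> g" for w
  proof (rule ccontr)
    assume "\<not> ?thesis"
    then have eq: "nbr G w = nbr H w" using nbrs by blast
    obtain t where t: "g = {w, t}" using edge_at[of g w] g w by blast
    have "t \<in> nbr G w \<longleftrightarrow> t \<in> nbr H w" by (simp add: eq)
    then show False using g t by (simp add: mem_nbr)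
  qed
  have "\<not> (u \<in> K \<and> v \<in> K)" "\<not> (u \<in> L \<and> v \<in> L)"
    using complete_onD[OF KH, of u v] sym.edge_K[of u v] g uv by auto
  then have "u \<in> K - L \<and> v \<in> L - K \<or> v \<in> K - L \<and> u \<in> L - K" using out uv by blast
  then show thesis using that[of u v] that[of v u] uv by (auto simp: insert_commute)
qed

lemma (in split_pair) differ_at_closed:
  assumes at: "\<And>e. e \<in> differ G H \<Longrightarrow> i \<in> e" and i: "i \<notin> K"
    and E: "E \<in> W" "g \<in> G - H" "h \<in> G - H" "g \<in> E"
  shows "h \<in> E"
proof -
  have sub: "k \<subseteq> insert i (nbr G i)" if k: "k \<in> G - H" for k
  proof -
    have "i \<in> k" using at k by (auto simp: differ_def)
    then obtain z where "k = {i, z}" using edge_at[of k i] k by blast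
    then show ?thesis using k by (auto simp: mem_nbr)
  qed
  have "complete_on G (insert i (nbr G i))" by (intro complete_on_closed_nbr nbr_clique i)
  then show ?thesis by (rule W_closed_G[OF E(1) _ E(2) sub[OF E(2)] E(3) sub[OF E(3)] E(4)])
qed

text \<open>Now \<open>K\<close> is a clique of \<open>H\<close> and \<open>L\<close> a clique of
  \<open>G\<close>, so \<open>K - L\<close> and \<open>L - K\<close> have at most one vertex each.
  If no vertex outside both cliques sees a difference, \<open>G\<close> and \<open>H\<close> differ
  in a single edge and no third graph occurs. Otherwise such a vertex can be exchanged, unless it
  carries all differences.\<close>

lemma (in split_pair) empty_cores_exchangeable:
  assumes cores: "core G H K = {}" "core H G L = {}" and D: "D \<in> W" "D \<noteq> G" "D \<noteq> H"
  shows "exchangeable G H"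
proof -
  have KH: "{u, v} \<in> H" if "u \<in> K" "v \<in> K" "u \<noteq> v" for u v
    using edge_in_K_core[of u v] edge_K[OF that] cores that by blast
  have LG: "{u, v} \<in> G" if "u \<in> L" "v \<in> L" "u \<noteq> v" for u v
    using sym.edge_in_K_core[of u v] sym.edge_K[OF that] cores that by blast
  have clH: "complete_on H (nbr G i)" if "i \<notin> K" for i
    using nbr_subset[OF that] KH by (auto simp: complete_on_def)
  have clG: "complete_on G (nbr H i)" if "i \<notin> L" for i
    using sym.nbr_subset[OF that] LG by (auto simp: complete_on_def)
  have D_differ: "e \<in> differ G H" if "(e \<in> D) \<noteq> (e \<in> G) \<or> (e \<in> D) \<noteq> (e \<in> H)" for e
    using that W_lower[OF D(1), of e] W_upper[OF D(1), of e] by (auto simp: differ_def)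
  obtain e where e: "e \<in> differ G H" "\<not> agrees G e D"
  proof -
    obtain e where "(e \<in> D) \<noteq> (e \<in> G)" using D(2) by blast
    then show thesis using that D_differ[of e] by (simp add: agrees_def)
  qed
  obtain f where f: "f \<in> differ G H" "agrees G f D"
  proof -
    obtain f where "(f \<in> D) \<noteq> (f \<in> H)" using D(3) by blast
    then show thesis using that[of f] D_differ[of f] agrees_other[of f D] by (simp add: agrees_def)
  qed
  show ?thesis
  proof (cases "\<exists>i. i \<notin> K \<and> i \<notin> L \<and> nbr G i \<noteq> nbr H i")
    case False
    then have nbrs: "\<And>i. i \<notin> K \<Longrightarrow> i \<notin> L \<Longrightarrow> nbr G i = nbr H i"
        "\<And>i. i \<notin> L \<Longrightarrow> i \<notin> K \<Longrightarrow> nbr H i = nbr G i"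
      by blast+
    have ab: "\<exists>a b. g = {a, b} \<and> a \<in> K - L \<and> b \<in> L - K" if g: "g \<in> differ G H" for g
    proof (cases "g \<in> G")
      case True
      then have "g \<in> G - H" using g by (auto simp: differ_def)
      moreover have "complete_on H K" using KH by (simp add: complete_on_def)
      ultimately show ?thesis using inner_difference[OF nbrs(1)] by metis
    next
      case False
      then have "g \<in> H - G" using g by (auto simp: differ_def)
      moreover have "complete_on G L" using LG by (simp add: complete_on_def)
      ultimately obtain b a where "g = {b, a}" "b \<in> L - K" "a \<in> K - L"
        using sym.inner_difference[OF nbrs(2)] by metis
      then show ?thesis by (metis insert_commute)
    qed
    have oneK: "a = a'" if "a \<in> K - L" "a' \<in> K - L" for a a'
      using KH[of a a'] sym.in_K[of a a'] that by blast
    have oneL: "b = b'" if "b \<in> L - K" "b' \<in> L - K" for b b'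
      using LG[of b b'] in_K[of b b'] that by blast
    obtain a b where "e = {a, b}" "a \<in> K - L" "b \<in> L - K" using ab[OF e(1)] by blast
    moreover obtain a' b' where "f = {a', b'}" "a' \<in> K - L" "b' \<in> L - K" using ab[OF f(1)] by blast
    ultimately have "e = f" using oneK oneL by blast
    then show ?thesis using e f by blast
  next
    case True
    then obtain i where i: "i \<notin> K" "i \<notin> L" "nbr G i \<noteq> nbr H i" by blast
    show ?thesis
    proof (cases "\<exists>g\<in>differ G H. i \<notin> g")
      case True
      then show ?thesis using vertex_swap[OF i(1,2) clH[OF i(1)] clG[OF i(2)] i(3)] by blast
    next
      case False
      then have at_i: "i \<in> g" if "g \<in> differ G H" for g using that by blast
      have at_i': "i \<in> g" if "g \<in> differ H G" for g using at_i that by (simp add: differ_commute)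
      have closedG: "h \<in> E" if "E \<in> W" "g \<in> G - H" "h \<in> G - H" "g \<in> E" for E g h
        by (rule differ_at_closed[OF _ i(1) that]) (rule at_i)
      have closedH: "h \<in> E" if "E \<in> W" "g \<in> H - G" "h \<in> H - G" "g \<in> E" for E g h
        by (rule sym.differ_at_closed[OF _ i(2) that]) (rule at_i')
      \<comment> \<open>All edges of \<open>G - H\<close> are tied, and so are those of
        \<open>H - G\<close>. Hence \<open>D\<close>, being neither \<open>G\<close> nor
        \<open>H\<close>, contains all of them or none; in the latter case tightness supplies a
        member containing all.\<close>
      obtain E where E: "E \<in> W" and full: "G - H \<subseteq> E" "H - G \<subseteq> E"
          and ne: "G - H \<noteq> {}" "H - G \<noteq> {}"
      proof -
        consider "e \<in> G - H" "f \<in> H - G" | "e \<in> H - G" "f \<in> G - H"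
          using e f closedG[OF D(1), of f e] closedG[OF D(1), of e f] closedH[OF D(1), of f e] closedH[OF D(1), of e f]
          by (auto simp: differ_def agrees_def)
        then show thesis
        proof cases
          case 1
          have "\<exists>E\<in>W. agrees G e E \<and> \<not> agrees G f E"
          proof (rule ccontr)
            assume "\<not> ?thesis"
            then have imp: "\<And>E. E \<in> W \<Longrightarrow> agrees G e E \<Longrightarrow> agrees G f E" by blast
            then show False using W_tight[OF D(1) e(1) f(1) imp f(2)] e by blast
          qed
          then obtain E where "E \<in> W" "e \<in> E" "f \<in> E" using 1 by (auto simp: agrees_def)
          then show thesis using that[of E] closedG[of E e] closedH[of E f] 1 by blast
        next
          case 2
          then have "e \<in> D" "f \<in> D" using e f by (auto simp: agrees_def)
          then show thesis using that[of D] closedG[OF D(1), of f] closedH[OF D(1), of e] 2 D(1) by blast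
        qed
      qed
      have E_eq: "E = G \<union> H"
        using full W_lower[OF E] W_upper[OF E] by blast
      have sG: "swap G (H - G) = E" and sH: "swap H (H - G) = G \<inter> H"
        unfolding E_eq by (auto simp: swap_def)
      have chI: "chordal (G \<inter> H)"
      proof (rule chordal_elimination)
        show "simple_graph (G \<inter> H)" using simple_G by (auto simp: simple_graph_def)
        have "restrict_graph (G \<inter> H) (- {i}) = restrict_graph G (- {i})"
          using at_i by (fastforce simp: restrict_graph_def differ_def)
        then show "chordal (restrict_graph (G \<inter> H) (- {i}))" using chordal_restrict[OF chordal_G] by simp
        fix Y assume Y: "Y \<noteq> {}" "Y \<inter> - {i} = {}"
        have nb: "{x, y} \<in> G \<inter> H" if "x \<noteq> y" "{i, x} \<in> G \<inter> H"
            "{i, y} \<in> G \<inter> H" for x y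
          using edge_K[of x y] KH[of x y] in_K[of i x] in_K[of i y] i that by blast
        show "\<exists>v\<in>Y. \<forall>x\<in>- {i} \<union> Y. \<forall>y\<in>- {i} \<union> Y. x \<noteq> y \<longrightarrow> {v, x} \<in> G \<inter> H \<longrightarrow> {v, y} \<in> G \<inter> H \<longrightarrow> {x, y} \<in> G \<inter> H"
        proof (intro bexI[of _ i] ballI impI)
          show "i \<in> Y" using Y by blast
        qed (rule nb)
      qed
      have "half_exchange G H (H - G)"
        unfolding half_exchange_def sG using W_chordal[OF E] W_clique[OF E] by blast
      moreover have "half_exchange H G (H - G)"
        unfolding half_exchange_def sH using chI by (auto simp: complete_on_def)
      moreover have "H - G \<subseteq> differ G H" "H - G \<noteq> differ G H" using ne by (auto simp: differ_def)
      ultimately show ?thesis unfolding exchangeable_def using ne by blast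
    qed
  qed
qed

section \<open>Case distinction on the cores, and the theorem\<close>

lemma (in split_pair) exchangeable_if_third:
  assumes D: "D \<in> W" "D \<noteq> G" "D \<noteq> H"
  shows "exchangeable G H"
proof (cases "core G H K \<union> core H G L = {}")
  case True
  then show ?thesis using empty_cores_exchangeable D by blast
next
  case ne: False
  then obtain r where r: "r \<in> core G H K \<union> core H G L" by blast
  have core_differ: "core G H K \<union> core H G L \<subseteq> differ G H" by (auto simp: core_def differ_def)
  show ?thesis
  proof (cases "\<forall>D\<in>W. \<forall>e\<in>core G H K \<union> core H G L. agrees G e D \<longleftrightarrow> agrees G r D")
    case True
    interpret linked_cores G H K L W r by unfold_locales (use r True in blast)+
    show ?thesis using linked_exchangeable D by blast
  next
    case False
    then obtain E e where E: "E \<in> W" "e \<in> core G H K \<union> core H G L"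
        "agrees G e E \<noteq> agrees G r E" by blast
    have same: "agrees G g F \<longleftrightarrow> agrees G h F"
      if "F \<in> W"
          "g \<in> core G H K \<and> h \<in> core G H K \<or> g \<in> core H G L \<and> h \<in> core H G L" for F g h
      using that core_agree[of F g h] sym.core_agree[of F g h] by (auto simp: agrees_def core_def)
    \<comment> \<open>Each core moves as a block, so a disagreement with \<open>r\<close> must occur
      between the two different cores.\<close>
    obtain g h where g: "g \<in> core G H K" and h: "h \<in> core H G L" and gh: "agrees G g E \<noteq> agrees G h E"
      using E r same[OF E(1), of e r] by blast
    have dif: "g \<in> differ G H" "h \<in> differ G H" using core_differ g h by auto
    \<comment> \<open>Agreement with \<open>G\<close> on \<open>g\<close> but not on
      \<open>h\<close> means containing both, since \<open>h\<close> is an edge of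
      \<open>H - G\<close>. Were there no such member, tightness would make the two agreements
      equivalent, against \<open>E\<close>. The opposite pattern gives a member with
      neither.\<close>
    have "\<exists>F\<in>W. agrees G g F \<and> \<not> agrees G h F"
    proof (rule ccontr)
      assume "\<not> ?thesis"
      then have imp: "\<And>F. F \<in> W \<Longrightarrow> agrees G g F \<Longrightarrow> agrees G h F" by blast
      then show False using W_tight[OF E(1) dif imp] gh E(1) by blast
    qed
    then obtain D1 where D1: "D1 \<in> W" "agrees G g D1" "\<not> agrees G h D1" by blast
    have "\<exists>F\<in>W. agrees G h F \<and> \<not> agrees G g F"
    proof (rule ccontr)
      assume "\<not> ?thesis"
      then have imp: "\<And>F. F \<in> W \<Longrightarrow> agrees G h F \<Longrightarrow> agrees G g F" by blast
      then show False using W_tight[OF E(1) dif(2,1) imp] gh E(1) by blast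
    qed
    then obtain D0 where D0: "D0 \<in> W" "agrees G h D0" "\<not> agrees G g D0" by blast
    have D1_core: "core G H K \<union> core H G L \<subseteq> D1"
      using same[OF D1(1), of g] same[OF D1(1), of h] g h D1 by (auto simp: agrees_def core_def)
    have D0_core: "(core G H K \<union> core H G L) \<inter> D0 = {}"
      using same[OF D0(1), of g] same[OF D0(1), of h] g h D0 by (auto simp: agrees_def core_def)
    obtain k where k: "k \<in> G - H" "k \<subseteq> K" using core_in_clique g by blast
    then have kd: "k \<in> differ G H" by (simp add: differ_def)
    show ?thesis
    proof (rule ccontr)
      assume no: "\<not> exchangeable G H"
      interpret unlinked_cores G H K L W D1 D0
      proof unfold_locales
        show "nbr G i = nbr H i"
          if "i \<notin> K" "i \<notin> L" "complete_on H (nbr G i)" "complete_on G (nbr H i)" for i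
          using vertex_swap[OF that _ kd] no k that by blast
        show "\<exists>v\<in>Y. \<forall>u\<in>Y. \<not> arc G H K L u v"
          if Y: "Y \<noteq> {}" "\<And>v. v \<in> Y \<Longrightarrow> \<exists>u. arc G H K L v u" for Y
        proof (rule ccontr)
          assume cyc: "\<not> ?thesis"
          define p where "p v = (SOME u. arc G H K L v u)" for v
          have p: "arc G H K L v (p v)" if "v \<in> Y" for v
            using someI_ex[OF Y(2)[OF that]] by (simp add: p_def)
          have "Y \<subseteq> p ` Y"
          proof
            fix v assume "v \<in> Y"
            then obtain u where u: "u \<in> Y" "arc G H K L u v" using cyc by blast
            then have "p u = v" using arc_unique p by blast
            then show "v \<in> p ` Y" using u by blast
          qed
          then show False using arc_cycle_swap[OF Y(1) p _ ne] no by blast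
        qed
      qed (use D1 D0 D1_core D0_core g h in blast)+
      show False using unlinked_exchangeable no by blast
    qed
  qed
qed

theorem theorem3p16:
  fixes G H :: "('n::finite) edges"
  assumes "split_graph G" and "split_graph H" and "G \<noteq> H"
  shows "rhombus_criterion (CGP :: (real ^ ('n set)) set) (char_imset G) (char_imset H)"
proof -
  obtain K I where K: "simple_graph G" "K \<union> I = UNIV" "complete_on G K" "independent_in G I"
    using assms(1) by (auto simp: split_graph_def)
  obtain L J where L: "simple_graph H" "L \<union> J = UNIV" "complete_on H L" "independent_in H J"
    using assms(2) by (auto simp: split_graph_def)
  have ind: "independent_in G (- K)" "independent_in H (- L)"
    using K L unfolding independent_in_def by blast+
  have chordal: "chordal G" "chordal H" using split_chordal K L ind by blast+
  show ?thesis
  proof (cases "midpoint_support G H \<subseteq> {G, H}")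
    case True
    then show ?thesis
      using edge_if_small_support[OF chordal assms(3)] by (simp add: rhombus_criterion_def)
  next
    case False
    then obtain D where D: "D \<in> midpoint_support G H" "D \<noteq> G" "D \<noteq> H" by blast
    interpret split_pair G H K L "midpoint_support G H"
    proof
      show "chordal E" if "E \<in> midpoint_support G H" for E
        using that by (force simp: midpoint_support_def midpoint_weights_def)
      show "f \<in> E" if "E \<in> midpoint_support G H" "complete_on H S" "e \<in> H - G" "e \<subseteq> S"
          "f \<in> H - G" "f \<subseteq> S" "e \<in> E" for E S e f
        using support_closed[of E H G S e f] that L(1) midpoint_support_commute[of G H] by simp
      show "e \<in> G \<or> e \<in> H" if "E \<in> midpoint_support G H" "e \<in> E" for E e
        by (rule support_upper[OF that])
      show "complete_on G S \<or> complete_on H S" if "E \<in> midpoint_support G H" "complete_on E S" for E S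
        by (rule support_clique[OF that])
      show "f \<in> E" if "E \<in> midpoint_support G H" "complete_on G S" "e \<in> G - H" "e \<subseteq> S"
          "f \<in> G - H" "f \<subseteq> S" "e \<in> E" for E S e f
        by (rule support_closed[OF that(1) K(1) that(2-7)])
      show "agrees G e E"
        if "E \<in> midpoint_support G H" "e \<in> differ G H" "f \<in> differ G H"
          "\<And>D. D \<in> midpoint_support G H \<Longrightarrow> agrees G e D \<Longrightarrow>
              agrees G f D" "agrees G f E" for E e f
        by (rule support_tight[OF that(1) K(1) L(1) that(2-5)])
    qed (fact K L ind | erule support_lower[OF _ K(1)]; assumption)+
    show ?thesis using exchangeable_rhombus[OF exchangeable_if_third[OF D] K(1) L(1)] .
  qed
qed

end
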